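(* Let $G=SL(2,\mathbb{R})$ and let $\lambda\in\Pi$, i.e. $\lambda\in\mathfrak{a}_{\mathbb{C}}^*$ is such that the spherical function $\phi_\lambda$ on $G/K$ is positive definite. Then the holomorphic extension of $\phi_\lambda$ to the complex crown $\Xi$ (also denoted $\phi_\lambda$) is bounded on $\Xi$, i.e. $\sup_{z\in\Xi}|\phi_\lambda(z)|<\infty$.
   Context: $G=SL(2,\mathbb{R})$, $K=SO(2,\mathbb{R})$, $G_{\mathbb{C}}=SL(2,\mathbb{C})$, $K_{\mathbb{C}}=SO(2,\mathbb{C})$. $\mathfrak{a}=\{\mathrm{diag}(t,-t): t\in\mathbb{R}\}$, $A=\exp(\mathfrak{a})=\{\mathrm{diag}(s,s^{-1}): s>0\}$, and $N=\left\{\begin{pmatrix}1&x\\0&1\end{pmatrix}: x\in\mathbb{R}\right\}$. The positive root is $\alpha(\mathrm{diag}(t,-t))=2t$, $\rho=\frac12\alpha$, and $\Omega=\{X\in\mathfrak{a}: |\alpha(X)|<\pi/2\}=\{\mathrm{diag}(t,-t): |t|<\pi/4\}$. The complex crown is $\Xi=G\exp(i\Omega)K_{\mathbb{C}}/K_{\mathbb{C}}\subseteq G_{\mathbb{C}}/K_{\mathbb{C}}$, a $G$-invariant domain containing $G/K$. For $g\in G=NAK$ (Iwasawa decomposition), $a(g)\in A$ is defined by $g\in N a(g)K$. For $\lambda\in\mathfrak{a}_{\mathbb{C}}^*$ (complex-valued linear functionals) and $a\in A$, $a^\lambda=e^{\lambda(\log a)}$. The spherical function with parameter $\lambda$ is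 $$\phi_\lambda(gK)=\int_K a(kg)^{\rho-\lambda}\,dk\qquad(g\in G),$$ with $dk$ the normalized Haar measure on $K$. $\Pi=\{\lambda\in\mathfrak{a}_{\mathbb{C}}^*: \phi_\lambda \text{ is positive definite}\}$, where positive definite refers to $\phi_\lambda$ viewed as a $K$-bi-invariant function on $G$. It is known that for every $\lambda\in\mathfrak{a}_{\mathbb{C}}^*$ the function $\phi_\lambda$ has a unique holomorphic extension from $G/K$ to $\Xi$. *)

theory Defs
  imports "HOL-Analysis.Analysis"
begin

section \<open>The groups and their subgroups\<close>

text \<open>
  The groups are subsets of the type of 2 by 2 matrices; the same constant gives \<open>SL(2,\<real>)\<close> or
  \<open>SL(2,\<complex>)\<close>, and \<open>SO(2,\<real>)\<close> or \<open>SO(2,\<complex>)\<close>, depending on the type of the entries.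
  Orthogonality is with respect to the bilinear form, so that \<open>SO(2,\<complex>)\<close> is not compact.
\<close>

definition SL2 :: "('a::comm_ring_1 ^ 2 ^ 2) set" where
  "SL2 = {g. det g = 1}"

definition SO2 :: "('a::comm_ring_1 ^ 2 ^ 2) set" where
  "SO2 = {k \<in> SL2. orthogonal_matrix k}"

definition diag2 :: "'a::zero \<Rightarrow> 'a \<Rightarrow> 'a ^ 2 ^ 2" where
  "diag2 x y = vector [vector [x, 0], vector [0, y]]"

definition lie_a :: "(real ^ 2 ^ 2) set" where
  "lie_a = range (\<lambda>t. diag2 t (- t))"

text \<open>The matrix exponential, restricted to diagonal matrices (the only ones it is applied to).\<close>

definition exp_diag :: "'a::{banach,real_normed_field} ^ 2 ^ 2 \<Rightarrow> 'a ^ 2 ^ 2" where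
  "exp_diag X = diag2 (exp (X $ 1 $ 1)) (exp (X $ 2 $ 2))"

definition grp_A :: "(real ^ 2 ^ 2) set" where
  "grp_A = exp_diag ` lie_a"

definition log_A :: "real ^ 2 ^ 2 \<Rightarrow> real ^ 2 ^ 2" where
  "log_A = the_inv_into lie_a exp_diag"

definition grp_N :: "(real ^ 2 ^ 2) set" where
  "grp_N = range (\<lambda>x. vector [vector [1, x], vector [0, 1]])"

definition iwasawa_a :: "real ^ 2 ^ 2 \<Rightarrow> real ^ 2 ^ 2" where
  "iwasawa_a g = (THE a. a \<in> grp_A \<and> (\<exists>n\<in>grp_N. \<exists>k\<in>SO2. g = n ** a ** k))"


section \<open>Functionals on \<open>\<aa>\<close>\<close>

text \<open>
  An element of \<open>\<aa>\<^sub>\<complex>\<^sup>*\<close> is a function on all matrices that is real-linear on \<open>\<aa>\<close>; its values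
  outside \<open>\<aa>\<close> are irrelevant.
\<close>

definition a_dual_C :: "(real ^ 2 ^ 2 \<Rightarrow> complex) set" where
  "a_dual_C = {l. (\<forall>X\<in>lie_a. \<forall>Y\<in>lie_a. l (X + Y) = l X + l Y) \<and>
                  (\<forall>c. \<forall>X\<in>lie_a. l (c *\<^sub>R X) = c *\<^sub>R l X)}"

definition root_alpha :: "real ^ 2 ^ 2 \<Rightarrow> real" where
  "root_alpha X = X $ 1 $ 1 - X $ 2 $ 2"

definition rho :: "real ^ 2 ^ 2 \<Rightarrow> complex" where
  "rho X = of_real (root_alpha X / 2)"

definition a_pow :: "real ^ 2 ^ 2 \<Rightarrow> (real ^ 2 ^ 2 \<Rightarrow> complex) \<Rightarrow> complex" where
  "a_pow a l = exp (l (log_A a))"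


section \<open>Normalized Haar measure on \<open>SO(2,\<real>)\<close>\<close>

definition rot :: "real \<Rightarrow> real ^ 2 ^ 2" where
  "rot t = vector [vector [cos t, - sin t], vector [sin t, cos t]]"

text \<open>
  The image of the normalized Lebesgue measure \<open>d\<theta>/2\<pi>\<close> under the rotation parametrization.
  That this is the normalized Haar measure is shown in \<open>emeasure_haar_K_space\<close> and
  \<open>haar_K_invariant\<close> below.
\<close>

definition haar_K :: "(real ^ 2 ^ 2) measure" where
  "haar_K = distr (uniform_measure lborel {0..<2 * pi}) (restrict_space borel SO2) rot"

lemma rot_in_SO2: "rot t \<in> SO2"
  by (auto simp: SO2_def SL2_def rot_def det_2 orthogonal_matrix_def matrix_matrix_mult_def
      transpose_def mat_def vec_eq_iff forall_2 sum_2 power2_eq_square [symmetric] algebra_simps)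

lemma rot_add: "rot (s + t) = rot s ** rot t"
  by (simp add: rot_def matrix_matrix_mult_def vec_eq_iff forall_2 sum_2 cos_add sin_add)

lemma rot_periodic: "rot (t + 2 * pi) = rot t"
  by (simp add: rot_def)

lemma SO2_imp_rot:
  assumes "k \<in> SO2"
  obtains t where "0 \<le> t" "t < 2 * pi" "k = rot t"
proof -
  have o: "transpose k ** k = mat 1" "k ** transpose k = mat 1" and d: "det k = 1"
    using assms by (auto simp: SO2_def SL2_def orthogonal_matrix_def)
  define a b c e where abce: "a = k$1$1" "b = k$1$2" "c = k$2$1" "e = k$2$2"
  have 1: "a * a + c * c = 1" "a * b + c * e = 0" "b * b + e * e = 1" "a * e - b * c = 1"
    using o d by (auto simp: abce vec_eq_iff forall_2 matrix_matrix_mult_def transpose_def mat_def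
        sum_2 det_2)
  have ea: "e = a" and bc: "b = - c"
    using 1 by algebra+
  obtain t where t: "0 \<le> t" "t < 2 * pi" "a = cos t" "c = sin t"
    using sincos_total_2pi [of a c] 1(1) by (auto simp: power2_eq_square)
  then have "k = rot t"
    using ea bc by (simp add: vec_eq_iff forall_2 rot_def flip: abce)
  with t that show thesis by blast
qed

lemma rot_continuous: "continuous_on UNIV rot"
proof -
  have "rot = (\<lambda>t. \<chi> i j. rot t $ i $ j)" by simp
  moreover have "continuous_on UNIV (\<lambda>t. \<chi> i j. rot t $ i $ j)"
  proof (intro continuous_on_vec_lambda)
    fix i j :: 2
    show "continuous_on UNIV (\<lambda>t. rot t $ i $ j)"
      using exhaust_2 [of i] exhaust_2 [of j]
      by (elim disjE; simp add: rot_def; intro continuous_intros)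
  qed
  ultimately show ?thesis by simp
qed

lemma rot_measurable: "rot \<in> lborel \<rightarrow>\<^sub>M restrict_space borel SO2"
  using borel_measurable_continuous_onI [OF rot_continuous]
  by (auto intro!: measurable_restrict_space2 simp: rot_in_SO2)

lemma emeasure_haar_K:
  assumes "A \<in> sets (restrict_space borel SO2)"
  shows "emeasure haar_K A = emeasure lborel ({0..<2 * pi} \<inter> rot -` A) / (2 * pi)"
proof -
  have "rot -` A \<in> sets lborel"
    using measurable_sets [OF rot_measurable assms] by simp
  then show ?thesis
    using rot_measurable assms
    by (simp add: haar_K_def emeasure_distr)
qed

lemma space_haar_K [simp]: "space haar_K = SO2"
  by (simp add: haar_K_def space_restrict_space)

lemma sets_haar_K: "sets haar_K = sets (restrict_space borel SO2)"
  by (simp add: haar_K_def)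

lemma emeasure_haar_K_space: "emeasure haar_K SO2 = 1"
proof -
  have "SO2 \<in> sets (restrict_space borel (SO2 :: (real^2^2) set))"
    using sets.top [of "restrict_space borel (SO2 :: (real^2^2) set)"]
    by (simp add: space_restrict_space)
  moreover have "rot -` SO2 = UNIV" using rot_in_SO2 by auto
  ultimately show ?thesis
    by (simp add: emeasure_haar_K ennreal_divide_self flip: ennreal_mult')
qed

lemma emeasure_lborel_shift:
  fixes c :: real
  assumes "B \<in> sets borel"
  shows "emeasure lborel {x. x + c \<in> B} = emeasure lborel B"
proof -
  have "emeasure lborel B = emeasure (distr lborel borel ((+) c)) B"
    by (simp add: lborel_distr_plus)
  also have "\<dots> = emeasure lborel {x. x + c \<in> B}"
    using assms by (simp add: emeasure_distr vimage_def add.commute)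
  finally show ?thesis by simp
qed

lemma haar_K_invariant:
  assumes k: "k \<in> SO2" and A: "A \<in> sets haar_K"
  shows "emeasure haar_K {x \<in> SO2. k ** x \<in> A} = emeasure haar_K A"
proof -
  obtain c where c: "0 \<le> c" "c < 2 * pi" "k = rot c"
    using SO2_imp_rot [OF k] .
  define E where "E = rot -` A"
  have E: "E \<in> sets borel"
    using measurable_sets [OF rot_measurable, of A] A by (simp add: E_def sets_haar_K)
  have per: "t + 2 * pi \<in> E \<longleftrightarrow> t \<in> E" for t
    by (simp add: E_def rot_periodic)
  have SO2_mult: "rot c ** x \<in> SO2" if "x \<in> SO2" for x
    using SO2_imp_rot [OF that] by (metis rot_add rot_in_SO2)
  have cont: "continuous_on UNIV (\<lambda>x :: real^2^2. k ** x)"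
    by (intro linear_continuous_on linear_conv_bounded_linear [THEN iffD1])
       (auto intro!: linearI simp: matrix_matrix_mult_def vec_eq_iff sum.distrib algebra_simps
          sum_distrib_left)
  have meas: "(\<lambda>x. k ** x) \<in> restrict_space borel SO2 \<rightarrow>\<^sub>M restrict_space borel SO2"
    using borel_measurable_continuous_onI [OF cont] SO2_mult c(3)
    by (intro measurable_restrict_space3) auto
  have B: "{x \<in> SO2. k ** x \<in> A} \<in> sets (restrict_space borel SO2)"
    using measurable_sets [OF meas, of A] A
    by (simp add: sets_haar_K space_restrict_space vimage_def Int_def conj_commute)
  have vim: "rot -` {x \<in> SO2. k ** x \<in> A} = {t. t + c \<in> E}"
    using rot_in_SO2 by (auto simp: E_def c(3) rot_add [symmetric] add.commute)
  have "emeasure lborel ({0..<2 * pi} \<inter> {t. t + c \<in> E}) =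
      emeasure lborel {t. t + c \<in> {c..<2 * pi + c} \<inter> E}"
    by (rule arg_cong [where f = "emeasure lborel"]) auto
  also have "\<dots> = emeasure lborel ({c..<2 * pi + c} \<inter> E)"
    using E by (intro emeasure_lborel_shift) auto
  also have "{c..<2 * pi + c} \<inter> E = ({c..<2 * pi} \<inter> E) \<union> ({2 * pi..<2 * pi + c} \<inter> E)"
    using c by auto
  also have "emeasure lborel \<dots> =
      emeasure lborel ({c..<2 * pi} \<inter> E) + emeasure lborel ({2 * pi..<2 * pi + c} \<inter> E)"
    using E by (intro plus_emeasure [symmetric]) auto
  also have "emeasure lborel ({2 * pi..<2 * pi + c} \<inter> E) =
      emeasure lborel {t. t + 2 * pi \<in> {2 * pi..<2 * pi + c} \<inter> E}"
    using E by (intro emeasure_lborel_shift [symmetric]) auto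
  also have "{t. t + 2 * pi \<in> {2 * pi..<2 * pi + c} \<inter> E} = {0..<c} \<inter> E"
    using per by auto
  also have "emeasure lborel ({c..<2 * pi} \<inter> E) + emeasure lborel ({0..<c} \<inter> E) =
      emeasure lborel (({c..<2 * pi} \<inter> E) \<union> ({0..<c} \<inter> E))"
    using E by (intro plus_emeasure) auto
  also have "({c..<2 * pi} \<inter> E) \<union> ({0..<c} \<inter> E) = {0..<2 * pi} \<inter> E"
    using c by auto
  finally show ?thesis
    using emeasure_haar_K [OF B, unfolded vim] emeasure_haar_K [of A] A
    by (simp add: E_def sets_haar_K)
qed


section \<open>Spherical functions and positive definiteness\<close>

definition spherical :: "(real ^ 2 ^ 2 \<Rightarrow> complex) \<Rightarrow> real ^ 2 ^ 2 \<Rightarrow> complex" where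
  "spherical l g = (\<integral>k. a_pow (iwasawa_a (k ** g)) (\<lambda>X. rho X - l X) \<partial>haar_K)"

definition positive_definite_SL2R :: "(real ^ 2 ^ 2 \<Rightarrow> complex) \<Rightarrow> bool" where
  "positive_definite_SL2R f \<longleftrightarrow>
     (\<forall>(n::nat) g c. (\<forall>i<n. g i \<in> SL2) \<longrightarrow>
        (\<Sum>i<n. \<Sum>j<n. c i * cnj (c j) * f (matrix_inv (g j) ** g i)) \<in> \<real>\<^sub>\<ge>\<^sub>0)"

definition pos_def_params :: "(real ^ 2 ^ 2 \<Rightarrow> complex) set" where
  "pos_def_params = {l \<in> a_dual_C. positive_definite_SL2R (spherical l)}"


section \<open>The complex crown\<close>

text \<open>Points of \<open>G\<^sub>\<complex>/K\<^sub>\<complex>\<close> are left cosets, and \<open>G/K\<close> sits inside via \<open>gK \<mapsto> gK\<^sub>\<complex>\<close>.\<close>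

definition coset_KC :: "complex ^ 2 ^ 2 \<Rightarrow> (complex ^ 2 ^ 2) set" where
  "coset_KC z = (\<lambda>k. z ** k) ` SO2"

abbreviation complexify :: "real ^ 2 ^ 2 \<Rightarrow> complex ^ 2 ^ 2" where
  "complexify \<equiv> map_matrix complex_of_real"

definition crown_Omega :: "(real ^ 2 ^ 2) set" where
  "crown_Omega = {X \<in> lie_a. \<bar>root_alpha X\<bar> < pi / 2}"

definition crown :: "(complex ^ 2 ^ 2) set set" where
  "crown = {coset_KC (complexify g ** exp_diag (map_matrix (\<lambda>x. \<i> * complex_of_real x) X)) | g X.
              g \<in> SL2 \<and> X \<in> crown_Omega}"

text \<open>Complex differentiability in the four matrix entries.\<close>

definition complex_differentiable_at ::
    "(complex ^ 2 ^ 2 \<Rightarrow> complex) \<Rightarrow> complex ^ 2 ^ 2 \<Rightarrow> bool" where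
  "complex_differentiable_at f z \<longleftrightarrow>
     (\<exists>D. (f has_derivative D) (at z) \<and> (\<forall>c X. D (map_matrix (\<lambda>x. c * x) X) = c * D X))"

text \<open>
  A function on an open subset \<open>U\<close> of the closed complex submanifold \<open>SL(2,\<complex>)\<close> of \<open>\<complex>\<^sup>2\<^sup>\<times>\<^sup>2\<close> is
  holomorphic iff it is locally the restriction of a holomorphic function on an open subset of
  the ambient space.
\<close>

definition holomorphic_on_SL2C ::
    "(complex ^ 2 ^ 2 \<Rightarrow> complex) \<Rightarrow> (complex ^ 2 ^ 2) set \<Rightarrow> bool" where
  "holomorphic_on_SL2C f U \<longleftrightarrow>
     (\<forall>z\<in>U. \<exists>W h. open W \<and> z \<in> W \<and> (\<forall>w\<in>W. complex_differentiable_at h w) \<and>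
        (\<forall>w\<in>W \<inter> U. h w = f w))"

text \<open>
  \<open>SL(2,\<complex>) \<rightarrow> SL(2,\<complex>)/SO(2,\<complex>)\<close> is a surjective holomorphic submersion, so a function on the
  crown is holomorphic iff its pullback to the preimage of the crown is.
\<close>

definition holomorphic_on_crown :: "((complex ^ 2 ^ 2) set \<Rightarrow> complex) \<Rightarrow> bool" where
  "holomorphic_on_crown F \<longleftrightarrow>
     holomorphic_on_SL2C (\<lambda>z. F (coset_KC z)) {z \<in> SL2. coset_KC z \<in> crown}"

definition holomorphic_extension_to_crown ::
    "(real ^ 2 ^ 2 \<Rightarrow> complex) \<Rightarrow> ((complex ^ 2 ^ 2) set \<Rightarrow> complex) \<Rightarrow> bool" where
  "holomorphic_extension_to_crown f F \<longleftrightarrow>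
     holomorphic_on_crown F \<and> (\<forall>g\<in>SL2. F (coset_KC (complexify g)) = f g)"

end

theory Submission
  imports Defs "HOL-Complex_Analysis.Conformal_Mappings"
begin

text \<open>
  Put \<open>\<nu> = (\<lambda> - \<rho>)/2\<close>, evaluated on \<open>diag(1,-1)\<close>. The Iwasawa projection turns \<open>\<phi>\<^sub>\<lambda>(g)\<close> into
  the average over the circle of \<open>(\<bar>v g\<bar>\<^sup>2)\<^sup>\<nu>\<close>, \<open>v = (sin t, cos t)\<close>, which is the Legendre function
  \<open>P\<^sub>\<nu>\<close> at \<open>\<parallel>g\<parallel>\<^sup>2/2\<close>; in particular it is symmetric under \<open>\<nu> \<mapsto> -1-\<nu>\<close>. Positive definiteness makes
  \<open>\<phi>\<^sub>\<lambda>\<close> real and at most \<open>1\<close>, so the leading coefficient of \<open>\<phi>\<^sub>\<lambda> - 1\<close> at the identity, a positive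
  multiple of \<open>\<nu>\<^sup>2 + \<nu>\<close>, is a nonpositive real. Hence \<open>-1 \<le> Re \<nu> \<le> 0\<close>, and by symmetry one may
  assume \<open>-1/2 \<le> Re \<nu> \<le> 0\<close>.

  Along \<open>z \<mapsto> g diag(e\<^sup>z, 1/e\<^sup>z)\<close>, \<open>\<bar>Im z\<bar> < \<pi>/4\<close>, the extension is given by the same integral with
  \<open>\<bar>v g\<bar>\<^sup>2\<close> replaced by a complex quadratic form \<open>Q(v)\<close> of determinant \<open>1\<close> and positive real part. Since
  \<open>\<bar>Q\<^sup>\<nu>\<bar>\<close> is at most a constant times \<open>1 + 1/sqrt \<bar>Q\<bar>\<close>, it remains to bound the integral of
  \<open>1/sqrt \<bar>Q\<bar>\<close> uniformly, which follows by splitting \<open>Q\<close> into linear factors.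
\<close>

section \<open>Inverse square roots of binary forms on the circle\<close>

lemma has_integral_periodic_shift:
  fixes f :: "real \<Rightarrow> 'a::banach"
  assumes per: "\<And>x. f (x + p) = f x" and int: "f integrable_on {0..p}" and c: "0 \<le> c" "c \<le> p"
  shows "((\<lambda>x. f (x + c)) has_integral integral {0..p} f) {0..p}"
proof -
  have 1: "(f has_integral integral {0..c} f) {0..c}"
    and 2: "(f has_integral integral {c..p} f) {c..p}"
    using int c by (auto intro!: integrable_integral integrable_on_subinterval [OF int])
  \<comment> \<open>The piece over \<open>{0..c}\<close> is moved one period to the right, where it
    completes \<open>{c..p}\<close> to the interval \<open>{c..p + c}\<close>.\<close>
  have "((\<lambda>x. f (x + p)) has_integral integral {0..c} f) {0..c}"
    using 1 by (simp add: per)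
  then have "(f has_integral integral {0..c} f) {p..c + p}"
    by (subst has_integral_shift_real_ivl_iff [where c = p]) simp
  from has_integral_combine [OF _ _ 2 this] c
  have "(f has_integral (integral {c..p} f + integral {0..c} f)) {c..p + c}"
    by (simp add: add.commute)
  moreover have "integral {c..p} f + integral {0..c} f = integral {0..p} f"
    using c int by (simp add: add.commute Henstock_Kurzweil_Integration.integral_combine)
  ultimately show ?thesis
    by (subst (asm) has_integral_shift_real_ivl_iff [where c = c]) simp
qed

text \<open>Two consecutive periods of the shifted function give twice the integral, and scaling the
  variable by 2 halves it again. This serves for quadratic forms on the circle, which are functions
  of the double angle.\<close>

lemma has_integral_periodic_double:
  fixes f :: "real \<Rightarrow> 'a::banach"
  assumes per: "\<And>x. f (x + p) = f x" and int: "f integrable_on {0..p}" and c: "0 \<le> c" "c \<le> p"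
  shows "((\<lambda>x. f (2 * x + c)) has_integral integral {0..p} f) {0..p}"
proof -
  define g where "g = (\<lambda>x. f (x + c))"
  have g: "(g has_integral integral {0..p} f) {0..p}"
    unfolding g_def by (rule has_integral_periodic_shift [OF assms])
  have "g (x + p) = g x" for x
    using per [of "x + c"] by (simp add: g_def algebra_simps)
  then have "((\<lambda>x. g (x + p)) has_integral integral {0..p} f) {0..p}"
    using g by simp
  then have "(g has_integral integral {0..p} f) {p..p + p}"
    by (subst has_integral_shift_real_ivl_iff [where c = p]) simp
  from has_integral_combine [OF _ _ g this] c
  have "(g has_integral (2::real) *\<^sub>R integral {0..p} f) {0..2 * p}"
    by (simp add: scaleR_2)
  from has_integral_stretch_real [OF this, of 2]
  show ?thesis
    by (simp add: g_def)
qed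

text \<open>On the first quarter, \<open>1 \<le> cos x + sin x\<close> yields the majorant
  \<open>cos x / sqrt (sin x) + sqrt (sin x)\<close>, whose singular term has the primitive
  \<open>2 * sqrt (sin x)\<close>. Reflection and translation by \<open>pi\<close> carry
  integrability to the whole circle.\<close>

lemma integrable_inverse_sqrt_sin:
  "(\<lambda>x. 1 / sqrt \<bar>sin x\<bar>) integrable_on {0..2 * pi}"
proof -
  let ?h = "\<lambda>x::real. 1 / sqrt \<bar>sin x\<bar>"
  have "((\<lambda>x. cos x / sqrt (sin x)) has_integral (2 * sqrt (sin (pi/2)) - 2 * sqrt (sin 0))) {0..pi/2}"
  proof (rule fundamental_theorem_of_calculus_interior)
    show "continuous_on {0..pi/2} (\<lambda>x. 2 * sqrt (sin x))"
      by (intro continuous_intros)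
    fix x assume x: "x \<in> {0<..<pi/2}"
    then have "sin x > 0" by (intro sin_gt_zero) auto
    then show "((\<lambda>x. 2 * sqrt (sin x)) has_vector_derivative cos x / sqrt (sin x)) (at x)"
      unfolding has_real_derivative_iff_has_vector_derivative [symmetric]
      by (auto intro!: derivative_eq_intros simp: field_simps)
  qed simp
  moreover have "(\<lambda>x. sqrt (sin x)) integrable_on {0..pi/2}"
    by (intro integrable_continuous_real continuous_intros)
  ultimately have bd: "(\<lambda>x. cos x / sqrt (sin x) + sqrt (sin x)) integrable_on {0..pi/2}"
    by (intro integrable_add) auto
  have meas: "?h \<in> borel_measurable (lebesgue_on S)" for S
    by (intro measurable_restrict_space1 measurable_completion) measurable
  have I1: "?h integrable_on {0..pi/2}"
  proof (rule measurable_bounded_by_integrable_imp_integrable [OF meas bd])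
    fix x :: real assume x: "x \<in> {0..pi/2}"
    have s: "sin x \<ge> 0" "cos x \<ge> 0"
      using x by (auto intro: sin_ge_zero cos_ge_zero)
    have "1 \<le> cos x + sin x"
    proof (rule power2_le_imp_le)
      have "(cos x + sin x)\<^sup>2 = 1 + 2 * (cos x * sin x)"
        by (simp add: power2_sum)
      then show "1\<^sup>2 \<le> (cos x + sin x)\<^sup>2" using s by simp
    qed (use s in simp)
    show "norm (?h x) \<le> cos x / sqrt (sin x) + sqrt (sin x)"
    \<comment> \<open>At a zero of the sine both sides are 0, since division by zero yields
      0.\<close>
    proof (cases "sin x = 0")
      case False
      then have "sqrt (sin x) > 0" using s by simp
      with \<open>1 \<le> cos x + sin x\<close> s show ?thesis by (simp add: field_simps)
    qed auto
  qed auto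
  have "?h integrable_on {-(pi/2)..0}"
    using Henstock_Kurzweil_Integration.integrable_reflect_real [THEN iffD2, OF I1] by simp
  from integrable_shift_real_ivl [OF this, of "-pi"]
  have I2: "?h integrable_on {pi/2..pi}" by simp
  have I: "?h integrable_on {0..pi}"
    by (rule Henstock_Kurzweil_Integration.integrable_combine [OF _ _ I1 I2]) auto
  from integrable_shift_real_ivl [OF this, of "-pi"]
  have J: "?h integrable_on {pi..2 * pi}" by simp
  show ?thesis
    by (rule Henstock_Kurzweil_Integration.integrable_combine [OF _ _ I J]) auto
qed

text \<open>The real or the imaginary part of the form carries at least half of the squared norm of
  \<open>(p, q)\<close>. In polar coordinates that part is \<open>r * sin (t + d)\<close>, with
  \<open>2 * r\<close> at least the norm; hence the factor 2.\<close>

lemma linear_form_lower_bound: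
  fixes p q :: complex
  obtains d where "0 \<le> d" "d \<le> 2 * pi"
    "\<And>t. sqrt ((cmod p)\<^sup>2 + (cmod q)\<^sup>2) * \<bar>sin (t + d)\<bar> \<le> 2 * cmod (p * of_real (sin t) + q * of_real (cos t))"
proof -
  define N where "N = sqrt ((cmod p)\<^sup>2 + (cmod q)\<^sup>2)"
  have N2: "N\<^sup>2 = (Re p)\<^sup>2 + (Im p)\<^sup>2 + (Re q)\<^sup>2 + (Im q)\<^sup>2"
    by (simp add: N_def cmod_power2)
  have N0: "N \<ge> 0" by (simp add: N_def)
  have "\<exists>a b. a\<^sup>2 + b\<^sup>2 \<ge> N\<^sup>2 / 2 \<and>
     (\<forall>t. \<bar>a * sin t + b * cos t\<bar> \<le> cmod (p * of_real (sin t) + q * of_real (cos t)))"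
  proof (cases "(Re p)\<^sup>2 + (Re q)\<^sup>2 \<ge> N\<^sup>2 / 2")
    case True
    moreover have "\<bar>Re p * sin t + Re q * cos t\<bar> \<le> cmod (p * of_real (sin t) + q * of_real (cos t))" for t
      using abs_Re_le_cmod [of "p * of_real (sin t) + q * of_real (cos t)"] by simp
    ultimately show ?thesis by blast
  next
    case False
    then have "(Im p)\<^sup>2 + (Im q)\<^sup>2 \<ge> N\<^sup>2 / 2" using N2 by simp
    moreover have "\<bar>Im p * sin t + Im q * cos t\<bar> \<le> cmod (p * of_real (sin t) + q * of_real (cos t))" for t
      using abs_Im_le_cmod [of "p * of_real (sin t) + q * of_real (cos t)"] by simp
    ultimately show ?thesis by blast
  qed
  then obtain a b where ab: "a\<^sup>2 + b\<^sup>2 \<ge> N\<^sup>2 / 2"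
    and le: "\<And>t. \<bar>a * sin t + b * cos t\<bar> \<le> cmod (p * of_real (sin t) + q * of_real (cos t))"
    by blast
  define r where "r = sqrt (a\<^sup>2 + b\<^sup>2)"
  have "(2 * r)\<^sup>2 = 4 * (a\<^sup>2 + b\<^sup>2)"
    by (simp add: r_def power_mult_distrib)
  moreover have "N\<^sup>2 \<le> 2 * (a\<^sup>2 + b\<^sup>2)" "2 * (a\<^sup>2 + b\<^sup>2) \<le> 4 * (a\<^sup>2 + b\<^sup>2)"
    using ab by simp_all
  ultimately have "N\<^sup>2 \<le> (2 * r)\<^sup>2"
    by (metis order.trans)
  then have Nr: "N \<le> 2 * r" by (rule power2_le_imp_le) (simp add: r_def)
  show thesis
  proof (cases "r = 0")
    case True
    then have "N = 0" using Nr N0 by simp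
    then show ?thesis by (intro that [of 0]) (auto simp flip: N_def)
  next
    case False
    then have r: "r > 0" "r\<^sup>2 = a\<^sup>2 + b\<^sup>2"
      by (auto simp: r_def sum_power2_gt_zero_iff)
    have "(a / r)\<^sup>2 + (b / r)\<^sup>2 = (a\<^sup>2 + b\<^sup>2) / r\<^sup>2"
      by (simp add: power_divide add_divide_distrib)
    also have "\<dots> = 1"
      unfolding r(2) [symmetric] using r(1) by simp
    finally have "(a / r)\<^sup>2 + (b / r)\<^sup>2 = 1" .
    from sincos_total_2pi [OF this] obtain d where d: "0 \<le> d" "d < 2 * pi" "a / r = cos d" "b / r = sin d"
      by blast
    have "a * sin t + b * cos t = r * sin (t + d)" for t
      using r d(3,4) by (simp add: sin_add field_simps)
    then have "N * \<bar>sin (t + d)\<bar> \<le> 2 * cmod (p * of_real (sin t) + q * of_real (cos t))" for t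
      using le [of t] mult_right_mono [OF Nr, of "\<bar>sin (t + d)\<bar>"] r by (simp add: abs_mult)
    then show ?thesis using d by (intro that [of d]) (auto simp: N_def)
  qed
qed

text \<open>Rotation by \<open>t\<close> preserves the norm of \<open>(p, q)\<close>, and the left
  side is the modulus of one coordinate of the rotated vector.\<close>

lemma cmod_cross_le:
  fixes p q :: complex
  shows "cmod (p * of_real (cos t) - q * of_real (sin t)) \<le> sqrt ((cmod p)\<^sup>2 + (cmod q)\<^sup>2)"
proof -
  have "(cmod (p * of_real (cos t) - q * of_real (sin t)))\<^sup>2
      + (cmod (p * of_real (sin t) + q * of_real (cos t)))\<^sup>2
     = ((cmod p)\<^sup>2 + (cmod q)\<^sup>2) * ((sin t)\<^sup>2 + (cos t)\<^sup>2)"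
    unfolding cmod_power2 by (simp add: power2_eq_square del: sin_cos_squared_add3) algebra
  then show ?thesis
    by (intro real_le_rsqrt) (simp, metis le_add_same_cancel1 zero_le_power2)
qed

lemma negligible_sin_zeros: "negligible {t. sin (t + d) = (0::real)}"
proof -
  have "{t. sin (t + d) = 0} \<subseteq> (\<Union>i::int. {of_int i * pi - d})"
  proof
    fix t assume "t \<in> {t. sin (t + d) = 0}"
    then obtain i where "t + d = of_int i * pi" by (auto simp: sin_zero_iff_int2)
    then have "t = of_int i * pi - d" by simp
    then show "t \<in> (\<Union>i::int. {of_int i * pi - d})" by blast
  qed
  then show ?thesis
    by (rule negligible_subset [rotated]) (intro negligible_countable_Union; auto)
qed

text \<open>
  For unit \<open>v = (sin t, cos t)\<close>, expanding \<open>det (w\<^sub>1, w\<^sub>2)\<close> along \<open>v\<close> and its normal gives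
  \<open>2 \<le> \<bar>w\<^sub>1\<cdot>v\<bar> \<bar>w\<^sub>2\<bar> + \<bar>w\<^sub>2\<cdot>v\<bar> \<bar>w\<^sub>1\<bar>\<close>, so that the inverse of the product is at most the sum of the
  inverses of the normalized factors; their singularities are integrable after taking square
  roots, uniformly in \<open>w\<^sub>1\<close> and \<open>w\<^sub>2\<close>.
\<close>

lemma integral_inverse_sqrt_form_le:
  fixes p q p' q' :: complex
  defines "Q \<equiv> \<lambda>t. (p * of_real (sin t) + q * of_real (cos t)) * (p' * of_real (sin t) + q' * of_real (cos t))"
  assumes D: "cmod (p * q' - p' * q) = 2" and nz: "\<And>t. Q t \<noteq> 0"
  shows "integral {0..2 * pi} (\<lambda>t. 1 / sqrt (cmod (Q t)))
    \<le> 2 * integral {0..2 * pi} (\<lambda>t. 1 / sqrt \<bar>sin t\<bar>)"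
proof -
  let ?h = "\<lambda>x::real. 1 / sqrt \<bar>sin x\<bar>"
  define N N' where "N = sqrt ((cmod p)\<^sup>2 + (cmod q)\<^sup>2)" and "N' = sqrt ((cmod p')\<^sup>2 + (cmod q')\<^sup>2)"
  define L L' where "L t = p * of_real (sin t) + q * of_real (cos t)"
    and "L' t = p' * of_real (sin t) + q' * of_real (cos t)" for t
  obtain d where d: "0 \<le> d" "d \<le> 2 * pi" "\<And>t. N * \<bar>sin (t + d)\<bar> \<le> 2 * cmod (L t)"
    unfolding N_def L_def by (rule linear_form_lower_bound [of p q]) blast
  obtain d' where d': "0 \<le> d'" "d' \<le> 2 * pi" "\<And>t. N' * \<bar>sin (t + d')\<bar> \<le> 2 * cmod (L' t)"
    unfolding N'_def L'_def by (rule linear_form_lower_bound [of p' q']) blast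
  have per: "?h (x + 2 * pi) = ?h x" for x by simp
  have hd: "((\<lambda>t. ?h (t + d)) has_integral integral {0..2*pi} ?h) {0..2*pi}"
    by (rule has_integral_periodic_shift [OF per integrable_inverse_sqrt_sin d(1,2)])
  have hd': "((\<lambda>t. ?h (t + d')) has_integral integral {0..2*pi} ?h) {0..2*pi}"
    by (rule has_integral_periodic_shift [OF per integrable_inverse_sqrt_sin d'(1,2)])
  define f where "f t = 1 / sqrt (cmod (Q t))" for t
  \<comment> \<open>On \<open>Z\<close> a term of the majorant takes the default value 0, so the
    pointwise estimate is claimed only off this null set.\<close>
  define Z where "Z = {t. sin (t + d) = 0} \<union> {t. sin (t + d') = 0}"
  have Z: "negligible Z"
    unfolding Z_def by (intro negligible_Un negligible_sin_zeros)
  have fint: "f integrable_on {0..2*pi}"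
    unfolding f_def Q_def using nz
    by (intro integrable_continuous_real continuous_intros) (auto simp: Q_def)
  have pt: "f t \<le> ?h (t + d) + ?h (t + d')" if "t \<notin> Z" for t
  proof -
    define S S' where "S = \<bar>sin (t + d)\<bar>" and "S' = \<bar>sin (t + d')\<bar>"
    have S: "S > 0" "S' > 0" using that by (auto simp: S_def S'_def Z_def)
    have L: "L t \<noteq> 0" "L' t \<noteq> 0" and Q: "Q t = L t * L' t"
      using nz [of t] by (auto simp: Q_def L_def L'_def)
    have "L t * (p' * of_real (cos t) - q' * of_real (sin t))
       - L' t * (p * of_real (cos t) - q * of_real (sin t))
       = - (p * q' - p' * q) * ((of_real (sin t))\<^sup>2 + (of_real (cos t))\<^sup>2)"
      unfolding L_def L'_def by algebra
    also have "(of_real (sin t))\<^sup>2 + (of_real (cos t))\<^sup>2 = (1::complex)"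
      by (simp flip: of_real_power of_real_add)
    finally have "2 = cmod (L t * (p' * of_real (cos t) - q' * of_real (sin t))
       - L' t * (p * of_real (cos t) - q * of_real (sin t)))"
      using D by (simp add: norm_minus_commute)
    also have "\<dots> \<le> cmod (L t) * N' + cmod (L' t) * N"
      unfolding N_def N'_def
      by (intro order.trans [OF norm_triangle_ineq4] add_mono)
         (auto simp: norm_mult intro!: mult_left_mono cmod_cross_le)
    \<comment> \<open>The norms are replaced by means of the lower bounds on the linear factors;
      their factor 2 cancels against the determinant.\<close>
    also have "\<dots> \<le> cmod (L t) * (2 * cmod (L' t) / S') + cmod (L' t) * (2 * cmod (L t) / S)"
      using d(3) [of t] d'(3) [of t] S
      by (intro add_mono mult_left_mono) (auto simp: S_def S'_def field_simps)
    finally have "1 \<le> cmod (Q t) * (1 / S + 1 / S')"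
      by (simp add: Q norm_mult field_simps)
    then have "1 / cmod (Q t) \<le> 1 / S + 1 / S'"
      using nz [of t] by (simp add: field_simps)
    then have "sqrt (1 / cmod (Q t)) \<le> sqrt (1 / S + 1 / S')"
      by simp
    also have "\<dots> \<le> sqrt (1 / S) + sqrt (1 / S')"
      using S by (intro sqrt_add_le_add_sqrt) auto
    finally show ?thesis by (simp add: f_def S_def S'_def real_sqrt_divide)
  qed
  have "integral {0..2*pi} f = integral {0..2*pi} (\<lambda>t. if t \<in> Z then 0 else f t)"
    by (rule integral_spike [OF Z]) auto
  also have "\<dots> \<le> integral {0..2*pi} (\<lambda>t. ?h (t + d) + ?h (t + d'))"
  proof (rule integral_le)
    show "(\<lambda>t. if t \<in> Z then 0 else f t) integrable_on {0..2*pi}"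
      by (rule integrable_spike [OF fint Z]) auto
    show "(\<lambda>t. ?h (t + d) + ?h (t + d')) integrable_on {0..2*pi}"
      using hd hd' by (intro integrable_add) auto
  qed (use pt in auto)
  also have "\<dots> = 2 * integral {0..2*pi} ?h"
    using integral_unique [OF has_integral_add [OF hd hd']] by simp
  finally show ?thesis by (simp add: f_def [abs_def])
qed

section \<open>Legendre functions\<close>

lemma of_real_powr_eq_exp:
  "x > 0 \<Longrightarrow> complex_of_real x powr \<nu> = exp (\<nu> * of_real (ln x))"
  by (simp add: powr_def Ln_of_real)

lemma continuous_on_of_real_powr:
  fixes f :: "'a::topological_space \<Rightarrow> real"
  assumes "continuous_on S f" "\<And>x. x \<in> S \<Longrightarrow> f x > 0"
  shows "continuous_on S (\<lambda>x. complex_of_real (f x) powr \<nu>)"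
proof -
  have "continuous_on S (\<lambda>x. exp (\<nu> * of_real (ln (f x))))"
    using assms by (intro continuous_intros) (auto dest: assms(2))
  then show ?thesis
    by (rule continuous_on_eq) (simp add: assms of_real_powr_eq_exp)
qed

text \<open>These are the substitutions \<open>t \<mapsto> pi - t\<close> and
  \<open>t \<mapsto> 2 * pi - t\<close>, each carried out as a reflection at 0 and a
  translation.\<close>

lemma has_integral_cos_reflect:
  fixes f :: "real \<Rightarrow> 'a::banach"
  assumes "((\<lambda>t. f (cos t)) has_integral I) {0..pi}"
  shows "((\<lambda>t. f (- cos t)) has_integral I) {0..pi}" "((\<lambda>t. f (cos t)) has_integral (I + I)) {0..2 * pi}"
proof -
  have *: "((\<lambda>t. f (cos t)) has_integral I) {- pi..0}"
    using has_integral_reflect_real [THEN iffD2, OF assms] by simp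
  from has_integral_shift_real_ivl [OF this, of "- pi"]
  show "((\<lambda>t. f (- cos t)) has_integral I) {0..pi}" by simp
  from has_integral_shift_real_ivl [OF *, of "- (2 * pi)"]
  have "((\<lambda>t. f (cos t)) has_integral I) {pi..2 * pi}" by (simp add: cos_diff)
  from has_integral_combine [OF _ _ assms this]
  show "((\<lambda>t. f (cos t)) has_integral (I + I)) {0..2 * pi}" by simp
qed

text \<open>Laplace's integral for the Legendre function of degree \<nu>, meant for
  \<open>\<tau> \<ge> 1\<close>.\<close>

definition legendre :: "complex \<Rightarrow> real \<Rightarrow> complex" where
  "legendre \<nu> \<tau> =
     integral {0..2 * pi} (\<lambda>t. of_real (\<tau> + sqrt (\<tau>\<^sup>2 - 1) * cos t) powr \<nu>) / of_real (2 * pi)"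

lemma legendre_base_pos:
  fixes \<tau> c :: real
  assumes "\<tau> \<ge> 1" "\<bar>c\<bar> \<le> 1"
  shows "\<tau> + sqrt (\<tau>\<^sup>2 - 1) * c > 0"
proof -
  have "sqrt (\<tau>\<^sup>2 - 1) < sqrt (\<tau>\<^sup>2)" by (rule real_sqrt_less_mono) simp
  then have "sqrt (\<tau>\<^sup>2 - 1) < \<tau>" using assms by simp
  moreover have "\<bar>sqrt (\<tau>\<^sup>2 - 1) * c\<bar> \<le> sqrt (\<tau>\<^sup>2 - 1) * 1"
    unfolding abs_mult using assms by (intro mult_mono) auto
  ultimately show ?thesis by simp
qed

text \<open>
  Substitute \<open>\<psi>\<close> for \<open>t\<close>, where \<open>(\<tau> + R cos t) (\<tau> - R cos \<psi>) = 1\<close>; this is the action of the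
  diagonal group on the circle.
\<close>

lemma legendre_symmetric:
  assumes \<tau>: "\<tau> \<ge> 1"
  shows "legendre (- 1 - \<nu>) \<tau> = legendre \<nu> \<tau>"
proof -
  define R where "R = sqrt (\<tau>\<^sup>2 - 1)"
  have R2: "R\<^sup>2 = \<tau>\<^sup>2 - 1" using \<tau> by (simp add: R_def)
  have pos: "\<tau> + R * c > 0" if "\<bar>c\<bar> \<le> 1" for c
    unfolding R_def by (rule legendre_base_pos [OF \<tau> that])
  define u where "u t = \<tau> + R * cos t" for t
  have u: "u t > 0" for t unfolding u_def by (rule pos) simp
  \<comment> \<open>This will be the cosine of the new angle, written without division by
    \<open>R\<close>, which may vanish.\<close>
  define w where "w t = (\<tau> * cos t + R) / u t" for t
  define \<psi> where "\<psi> t = arccos (w t)" for t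
  have w2: "1 - (w t)\<^sup>2 = (sin t / u t)\<^sup>2" for t
  proof -
    have "(u t)\<^sup>2 - (\<tau> * cos t + R)\<^sup>2 = (\<tau>\<^sup>2 - R\<^sup>2) * (1 - (cos t)\<^sup>2)"
      unfolding u_def by algebra
    then have "(u t)\<^sup>2 - (\<tau> * cos t + R)\<^sup>2 = (sin t)\<^sup>2"
      by (simp add: R2 sin_squared_eq)
    moreover have "1 - (w t)\<^sup>2 = ((u t)\<^sup>2 - (\<tau> * cos t + R)\<^sup>2) / (u t)\<^sup>2"
      using u [of t] by (simp add: w_def power_divide diff_divide_distrib)
    ultimately show ?thesis
      by (simp add: power_divide)
  qed
  have w1: "\<bar>w t\<bar> \<le> 1" for t
  proof -
    have "(w t)\<^sup>2 \<le> 1" using w2 [of t] zero_le_power2 [of "sin t / u t"] by linarith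
    then show ?thesis by (simp add: abs_square_le_1)
  qed
  have inv: "\<tau> - R * w t = 1 / u t" for t
  proof -
    have "\<tau> * u t - R * (\<tau> * cos t + R) = 1"
      unfolding u_def using R2 by (simp add: algebra_simps power2_eq_square)
    then show ?thesis using u [of t] by (simp add: w_def field_simps)
  qed
  define h where "h x = complex_of_real (\<tau> - R * cos x) powr (- 1 - \<nu>)" for x
  have posm: "\<tau> - R * cos x > 0" for x using pos [of "- cos x"] by simp
  have hcont: "continuous_on S h" for S
    unfolding h_def using posm by (intro continuous_on_of_real_powr continuous_intros)
  have psi0: "\<psi> 0 = 0"
    using u [of 0] by (simp add: \<psi>_def w_def u_def)
  have psi_pi: "\<psi> pi = pi"
  proof -
    have "w pi = -1" using u [of pi] by (simp add: w_def u_def field_simps)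
    then show ?thesis by (simp add: \<psi>_def)
  qed
  have "((\<lambda>t. (1 / u t) *\<^sub>R h (\<psi> t)) has_integral (integral {\<psi> 0..\<psi> pi} h)) {0..pi}"
  \<comment> \<open>The endpoints are exceptional points because \<open>arccos\<close> is not
    differentiable at 1 and -1.\<close>
  proof (rule has_integral_substitution_strong [where s = "{0, pi}" and c = 0 and d = pi])
    show "\<psi> 0 \<le> \<psi> pi" by (simp add: psi0 psi_pi)
    show "\<psi> ` {0..pi} \<subseteq> {0..pi}"
      using w1 by (auto simp: \<psi>_def abs_le_iff minus_le_iff intro!: arccos_lbound arccos_ubound)
    have "continuous_on {0..pi} w"
      unfolding w_def using u
      by (intro continuous_intros) (auto simp: u_def less_imp_neq [symmetric] intro!: continuous_intros)
    then show "continuous_on {0..pi} \<psi>"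
      unfolding \<psi>_def using w1 by (intro continuous_intros) (auto simp: abs_le_iff)
    fix t assume "t \<in> {0..pi} - {0, pi}"
    then have t: "0 < t" "t < pi" by auto
    have st: "sin t > 0" using t by (rule sin_gt_zero)
    have "(sin t / u t)\<^sup>2 > 0" using st u [of t] by simp
    then have "(w t)\<^sup>2 < 1" using w2 [of t] by linarith
    then have w: "-1 < w t" "w t < 1" by (simp_all add: abs_square_less_1)
    have "(w has_real_derivative (((- \<tau> * sin t) * u t - (\<tau> * cos t + R) * (- R * sin t)) / (u t)\<^sup>2)) (at t)"
      unfolding w_def u_def using u [of t]
      by (auto intro!: derivative_eq_intros simp: u_def power2_eq_square)
    moreover have "(- \<tau> * sin t) * u t - (\<tau> * cos t + R) * (- R * sin t) = - sin t"
      unfolding u_def using R2 by algebra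
    ultimately have w': "(w has_real_derivative (- sin t / (u t)\<^sup>2)) (at t)" by simp
    have "(\<psi> has_real_derivative (inverse (- sqrt (1 - (w t)\<^sup>2)) * (- sin t / (u t)\<^sup>2))) (at t)"
      unfolding \<psi>_def by (rule DERIV_chain2 [OF DERIV_arccos [OF w] w'])
    also have "sqrt (1 - (w t)\<^sup>2) = sin t / u t"
      unfolding w2 using st u [of t] by simp
    also have "inverse (- (sin t / u t)) * (- sin t / (u t)\<^sup>2) = 1 / u t"
      using st u [of t] by (simp add: power2_eq_square)
    finally show "(\<psi> has_real_derivative 1 / u t) (at t within {0..pi})"
      by (rule has_field_derivative_at_within)
  qed (auto intro: hcont)
  \<comment> \<open>The derivative \<open>1 / u t\<close> of the substitution turns the power
    \<open>- 1 - \<nu>\<close> of \<open>1 / u t\<close> into the power \<nu> of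
    \<open>u t\<close>.\<close>
  moreover have "(1 / u t) *\<^sub>R h (\<psi> t) = of_real (u t) powr \<nu>" for t
  proof -
    have "cos (\<psi> t) = w t" using w1 [of t] by (simp add: \<psi>_def abs_le_iff)
    then have "h (\<psi> t) = of_real (1 / u t) powr (- 1 - \<nu>)" by (simp add: h_def inv)
    also have "\<dots> = exp ((- 1 - \<nu>) * of_real (ln (1 / u t)))"
      using u [of t] by (intro of_real_powr_eq_exp) simp
    also have "\<dots> = exp (\<nu> * of_real (ln (u t)) + of_real (ln (u t)))"
      using u [of t] by (simp add: ln_div algebra_simps)
    also have "\<dots> = of_real (u t) powr \<nu> * of_real (u t)"
      using u [of t] by (simp add: powr_def Ln_of_real exp_add exp_of_real)
    finally show ?thesis using u [of t] by (simp add: scaleR_conv_of_real)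
  qed
  ultimately have 1: "((\<lambda>t. of_real (u t) powr \<nu>) has_integral (integral {0..pi} h)) {0..pi}"
    by (simp add: psi0 psi_pi)
  have "(h has_integral integral {0..pi} h) {0..pi}"
    by (intro integrable_integral integrable_continuous_real hcont)
  from has_integral_cos_reflect(1) [of "\<lambda>c. complex_of_real (\<tau> - R * c) powr (- 1 - \<nu>)",
      OF this [unfolded h_def [abs_def]]]
  have 2: "((\<lambda>t. of_real (u t) powr (- 1 - \<nu>)) has_integral (integral {0..pi} h)) {0..pi}"
    by (simp add: u_def h_def [abs_def])
  show ?thesis
    using has_integral_cos_reflect(2) [of "\<lambda>c. complex_of_real (\<tau> + R * c) powr \<nu>", OF 1 [unfolded u_def]]
      has_integral_cos_reflect(2) [of "\<lambda>c. complex_of_real (\<tau> + R * c) powr (- 1 - \<nu>)", OF 2 [unfolded u_def]]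
    by (simp add: legendre_def integral_unique flip: R_def)
qed

section \<open>The spherical function as a circle average\<close>

lemma diag2_nth [simp]:
  "diag2 x y $ 1 $ 1 = x" "diag2 x y $ 1 $ 2 = 0" "diag2 x y $ 2 $ 1 = 0" "diag2 x y $ 2 $ 2 = y"
  by (simp_all add: diag2_def)

lemma matrix_mult_2_nth:
  fixes A B :: "'a::semiring_1 ^ 2 ^ 2"
  shows "(A ** B) $ i $ j = A $ i $ 1 * B $ 1 $ j + A $ i $ 2 * B $ 2 $ j"
  by (simp add: matrix_matrix_mult_def sum_2)

lemma SL2_D:
  assumes "g \<in> SL2"
  shows "g $ 1 $ 1 * g $ 2 $ 2 - g $ 1 $ 2 * g $ 2 $ 1 = 1"
  using assms by (simp add: SL2_def det_2)

lemma SL2_bottom_row_pos: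
  fixes g :: "real ^ 2 ^ 2"
  assumes "g \<in> SL2"
  shows "(g $ 2 $ 1)\<^sup>2 + (g $ 2 $ 2)\<^sup>2 > 0"
  using SL2_D [OF assms] by (auto simp: sum_power2_gt_zero_iff)

lemma SL2_mult: "g \<in> SL2 \<Longrightarrow> h \<in> SL2 \<Longrightarrow> g ** h \<in> SL2"
  by (simp add: SL2_def det_mul)

lemma rot_in_SL2: "rot t \<in> SL2"
  using rot_in_SO2 by (simp add: SO2_def)

lemma log_A_exp_diag: "log_A (exp_diag (diag2 u (- u))) = diag2 u (- u)"
  unfolding log_A_def
  by (rule the_inv_into_f_f) (auto simp: inj_on_def lie_a_def exp_diag_def vec_eq_iff forall_2)

text \<open>Multiplication by \<open>grp_N\<close> on the left fixes the bottom row and rotations on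
  the right preserve its length. So the length of the bottom row of \<open>g\<close> equals the
  lower diagonal entry of the \<open>grp_A\<close> factor.\<close>

lemma iwasawa_a_SL2:
  fixes g :: "real ^ 2 ^ 2"
  assumes g: "g \<in> SL2"
  defines "u \<equiv> - ln ((g $ 2 $ 1)\<^sup>2 + (g $ 2 $ 2)\<^sup>2) / 2"
  shows "iwasawa_a g = exp_diag (diag2 u (- u))"
  unfolding iwasawa_a_def
proof (rule the_equality)
  define a b c d where abcd: "a = g $ 1 $ 1" "b = g $ 1 $ 2" "c = g $ 2 $ 1" "d = g $ 2 $ 2"
  define r where "r = sqrt (c\<^sup>2 + d\<^sup>2)"
  have r: "r > 0" "r\<^sup>2 = c\<^sup>2 + d\<^sup>2"
    using SL2_bottom_row_pos [OF g] by (simp_all add: r_def abcd)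
  have det: "a * d - b * c = 1" using SL2_D [OF g] by (simp add: abcd)
  have "u = - ln r" using r by (simp add: u_def r_def abcd ln_sqrt)
  then have eu: "exp u = 1 / r" "exp (- u) = r" using r by (simp_all add: exp_minus divide_inverse)
  \<comment> \<open>The rotation takes the normalized bottom row of \<open>g\<close> as its own
    bottom row; the entry of \<open>?n\<close> is the inner product of the two rows of
    \<open>g\<close>, divided by \<open>r\<^sup>2\<close>.\<close>
  let ?n = "vector [vector [1, (a * c + b * d) / r\<^sup>2], vector [0, 1]] :: real^2^2"
  let ?k = "vector [vector [d / r, - c / r], vector [c / r, d / r]] :: real^2^2"
  have "(d / r) * (d / r) + (c / r) * (c / r) = (c\<^sup>2 + d\<^sup>2) / r\<^sup>2"
    by (simp add: power2_eq_square add_divide_distrib)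
  then have k1: "(d / r) * (d / r) + (c / r) * (c / r) = 1"
    unfolding r(2) [symmetric] using r(1) by simp
  have k: "?k \<in> SO2"
    using k1 by (simp add: SO2_def SL2_def det_2 orthogonal_matrix_def vec_eq_iff forall_2
        matrix_mult_2_nth transpose_def mat_def algebra_simps)
  have "a * r\<^sup>2 = d + (a * c + b * d) * c" "b * r\<^sup>2 = - c + (a * c + b * d) * d"
    unfolding r(2) using det by algebra+
  then have "a = d / r\<^sup>2 + (a * c + b * d) / r\<^sup>2 * c" "b = - c / r\<^sup>2 + (a * c + b * d) / r\<^sup>2 * d"
    using r(1) by (simp_all add: divide_simps)
  then have "g = ?n ** exp_diag (diag2 u (- u)) ** ?k"
    using r(1) eu
    by (simp add: vec_eq_iff forall_2 matrix_mult_2_nth exp_diag_def abcd [symmetric]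
        power2_eq_square)
  moreover have "?n \<in> grp_N" by (auto simp: grp_N_def)
  moreover have "exp_diag (diag2 u (- u)) \<in> grp_A" by (auto simp: grp_A_def lie_a_def)
  ultimately show "exp_diag (diag2 u (- u)) \<in> grp_A \<and>
      (\<exists>n\<in>grp_N. \<exists>k\<in>SO2. g = n ** exp_diag (diag2 u (- u)) ** k)"
    using k by blast
next
  fix A assume "A \<in> grp_A \<and> (\<exists>n\<in>grp_N. \<exists>k\<in>SO2. g = n ** A ** k)"
  then obtain t x k where A: "A = exp_diag (diag2 t (- t))" and k: "k \<in> SO2"
    and gA: "g = vector [vector [1, x], vector [0, 1]] ** A ** k"
    by (auto simp: grp_A_def lie_a_def grp_N_def)
  obtain s where "k = rot s" using SO2_imp_rot [OF k] by blast
  then have "(g $ 2 $ 1)\<^sup>2 + (g $ 2 $ 2)\<^sup>2 = (exp (- t))\<^sup>2 * ((sin s)\<^sup>2 + (cos s)\<^sup>2)"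
    unfolding gA A by (simp add: matrix_mult_2_nth exp_diag_def rot_def power_mult_distrib distrib_left del: sin_cos_squared_add)
  then have "u = t"
    by (simp add: u_def ln_realpow flip: exp_of_nat_mult)
  then show "A = exp_diag (diag2 u (- u))" by (simp add: A)
qed

definition qform :: "real ^ 2 ^ 2 \<Rightarrow> real \<Rightarrow> real" where
  "qform g t = (sin t * g $ 1 $ 1 + cos t * g $ 2 $ 1)\<^sup>2 + (sin t * g $ 1 $ 2 + cos t * g $ 2 $ 2)\<^sup>2"

lemma qform_altdef: "qform g t = ((rot t ** g) $ 2 $ 1)\<^sup>2 + ((rot t ** g) $ 2 $ 2)\<^sup>2"
  by (simp add: qform_def matrix_mult_2_nth rot_def)

lemma qform_pos: "g \<in> SL2 \<Longrightarrow> qform g t > 0"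
  unfolding qform_altdef by (intro SL2_bottom_row_pos SL2_mult rot_in_SL2)

definition spherical_exponent :: "(real ^ 2 ^ 2 \<Rightarrow> complex) \<Rightarrow> complex" where
  "spherical_exponent l = (l (diag2 1 (- 1)) - 1) / 2"

text \<open>The logarithm of the \<open>grp_A\<close> factor is minus half the logarithm of the
  squared bottom row length, and \<open>rho\<close> is 1 at \<open>diag2 1 (- 1)\<close>; this
  explains the sign and the halving in \<open>spherical_exponent\<close>.\<close>

lemma a_pow_iwasawa:
  fixes g :: "real ^ 2 ^ 2"
  assumes "g \<in> SL2" and l: "l \<in> a_dual_C"
  shows "a_pow (iwasawa_a g) (\<lambda>X. rho X - l X) =
    exp (spherical_exponent l * of_real (ln ((g $ 2 $ 1)\<^sup>2 + (g $ 2 $ 2)\<^sup>2)))"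
proof -
  define u where "u = - ln ((g $ 2 $ 1)\<^sup>2 + (g $ 2 $ 2)\<^sup>2) / 2"
  have "diag2 u (- u) = u *\<^sub>R diag2 1 (- 1)" by (simp add: vec_eq_iff forall_2)
  moreover have "diag2 1 (- 1) \<in> lie_a" by (auto simp: lie_a_def)
  ultimately have "l (diag2 u (- u)) = u *\<^sub>R l (diag2 1 (- 1))"
    using l by (simp add: a_dual_C_def)
  moreover have "a_pow (iwasawa_a g) (\<lambda>X. rho X - l X)
      = exp (rho (diag2 u (- u)) - l (diag2 u (- u)))"
    by (simp only: a_pow_def iwasawa_a_SL2 [OF assms(1)] log_A_exp_diag flip: u_def)
  ultimately show ?thesis
    by (simp add: rho_def root_alpha_def spherical_exponent_def scaleR_conv_of_real u_def field_simps)
qed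

lemma spherical_eq_integral:
  assumes g: "g \<in> SL2" and l: "l \<in> a_dual_C"
  shows "spherical l g =
    integral {0..2 * pi} (\<lambda>t. of_real (qform g t) powr spherical_exponent l) / of_real (2 * pi)"
proof -
  define \<nu> where "\<nu> = spherical_exponent l"
  \<comment> \<open>An explicit formula on all matrices, hence visibly Borel; it replaces an
    integrand that involves the description operator in \<open>iwasawa_a\<close>.\<close>
  define f where "f k = exp (\<nu> * of_real (ln (((k ** g) $ 2 $ 1)\<^sup>2 + ((k ** g) $ 2 $ 2)\<^sup>2)))"
    for k :: "real ^ 2 ^ 2"
  define h where "h t = complex_of_real (qform g t) powr \<nu>" for t
  have h: "f (rot t) = h t" for t
    using of_real_powr_eq_exp [OF qform_pos [OF g, of t], of \<nu>]
    by (simp only: h_def f_def qform_altdef)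
  have nth: "(\<lambda>k::real^2^2. k $ i $ j) \<in> borel_measurable borel" for i j
    by (intro borel_measurable_continuous_onI continuous_intros)
  have "f \<in> borel_measurable borel"
    unfolding f_def matrix_mult_2_nth using nth by measurable
  then have f: "f \<in> borel_measurable (restrict_space borel SO2)"
    by (rule measurable_restrict_space1)
  have hcont: "continuous_on S h" for S
    unfolding h_def using qform_pos [OF g]
    by (intro continuous_on_of_real_powr) (auto simp: qform_def intro!: continuous_intros)
  have hmeas: "h \<in> borel_measurable borel"
    by (rule borel_measurable_continuous_onI [OF hcont])
  have "spherical l g = (\<integral>k. f k \<partial>haar_K)"
    unfolding spherical_def
  proof (rule Bochner_Integration.integral_cong [OF refl])
    fix k assume "k \<in> space haar_K"
    then have "k ** g \<in> SL2" using g by (simp add: SO2_def SL2_mult)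
    from a_pow_iwasawa [OF this l]
    show "a_pow (iwasawa_a (k ** g)) (\<lambda>X. rho X - l X) = f k" by (simp add: f_def \<nu>_def)
  qed
  also have "\<dots> = (\<integral>t. h t \<partial>uniform_measure lborel {0..<2 * pi})"
  proof -
    have "rot \<in> uniform_measure lborel {0..<2 * pi} \<rightarrow>\<^sub>M restrict_space borel SO2"
      using rot_measurable by (simp add: measurable_def uniform_measure_def)
    from integral_distr [OF this f] show ?thesis by (simp add: haar_K_def h)
  qed
  also have "\<dots> = (\<integral>t. (indicator {0..<2 * pi} t / (2 * pi)) *\<^sub>R h t \<partial>lborel)"
  proof -
    have "uniform_measure lborel {0..<2 * pi}
        = density lborel (\<lambda>t. ennreal (indicator {0..<2 * pi} t / (2 * pi)))"
      unfolding uniform_measure_def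
      by (intro density_cong AE_I2) (auto simp: indicator_def divide_ennreal [symmetric] ennreal_mult'' simp flip: ennreal_1)
    moreover have "(\<integral>t. h t \<partial>density lborel (\<lambda>t. ennreal (indicator {0..<2 * pi} t / (2 * pi)))) =
        (\<integral>t. (indicator {0..<2 * pi} t / (2 * pi)) *\<^sub>R h t \<partial>lborel)"
      using hmeas by (intro integral_density) auto
    ultimately show ?thesis by simp
  qed
  also have "\<dots> = (LINT t:{0..<2 * pi}|lborel. h t) /\<^sub>R (2 * pi)"
  proof -
    have "(\<lambda>t. (indicator {0..<2 * pi} t / (2 * pi)) *\<^sub>R h t)
        = (\<lambda>t. inverse (2 * pi) *\<^sub>R (indicator {0..<2 * pi} t *\<^sub>R h t))"
      by (rule ext) (simp only: scaleR_scaleR divide_inverse mult.commute)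
    then show ?thesis
      unfolding set_lebesgue_integral_def by (simp only: integral_scaleR_right)
  qed
  also have "(LINT t:{0..<2 * pi}|lborel. h t) = integral {0..<2 * pi} h"
  proof (rule set_borel_integral_eq_integral(2))
    show "set_integrable lborel {0..<2 * pi} h"
      by (rule set_integrable_subset [OF borel_integrable_atLeastAtMost' [OF hcont, of 0 "2 * pi"]]) auto
  qed
  also have "\<dots> = integral {0..2 * pi} h"
    by (rule integral_spike_set; rule negligible_subset [of "{2 * pi}"]) auto
  finally show ?thesis by (simp add: h_def [abs_def] \<nu>_def scaleR_conv_of_real field_simps)
qed

section \<open>Positive definite spherical functions\<close>

text \<open>The hyperbolic cosine of the distance from \<open>\<i>\<close> to \<open>g \<i>\<close> in the upper half-plane.\<close>

definition cosh_dist :: "real ^ 2 ^ 2 \<Rightarrow> real" where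
  "cosh_dist g = ((g $ 1 $ 1)\<^sup>2 + (g $ 1 $ 2)\<^sup>2 + (g $ 2 $ 1)\<^sup>2 + (g $ 2 $ 2)\<^sup>2) / 2"

lemma cosh_dist_ge_1:
  assumes "g \<in> SL2"
  shows "cosh_dist g \<ge> 1"
proof -
  define a b c d where abcd: "a = g $ 1 $ 1" "b = g $ 1 $ 2" "c = g $ 2 $ 1" "d = g $ 2 $ 2"
  have det: "a * d - b * c = 1" using SL2_D [OF assms] by (simp add: abcd)
  have "2 * cosh_dist g - 2 * (a * d - b * c) = (a - d)\<^sup>2 + (b + c)\<^sup>2"
    by (simp add: cosh_dist_def abcd power2_eq_square algebra_simps)
  then have "2 * cosh_dist g - 2 = (a - d)\<^sup>2 + (b + c)\<^sup>2" by (simp add: det)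
  then have "2 * cosh_dist g - 2 \<ge> 0" by simp
  then show ?thesis by simp
qed

text \<open>In the double angle, \<open>qform g t\<close> is a constant \<tau> plus
  \<open>A * cos (2 * t) + B * sin (2 * t)\<close>. Determinant 1 fixes the amplitude to
  \<open>sqrt (\<tau>\<^sup>2 - 1)\<close>, and neither the phase nor the doubling changes the
  integral over the circle.\<close>

lemma integral_qform_eq_legendre:
  assumes g: "g \<in> SL2"
  shows "integral {0..2 * pi} (\<lambda>t. of_real (qform g t) powr \<nu>) / of_real (2 * pi)
    = legendre \<nu> (cosh_dist g)"
proof -
  define a b c d where abcd: "a = g $ 1 $ 1" "b = g $ 1 $ 2" "c = g $ 2 $ 1" "d = g $ 2 $ 2"
  define \<tau> where "\<tau> = (a\<^sup>2 + b\<^sup>2 + c\<^sup>2 + d\<^sup>2) / 2"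
  have \<tau>_eq: "cosh_dist g = \<tau>" by (simp add: cosh_dist_def \<tau>_def abcd)
  then have \<tau>: "\<tau> \<ge> 1" using cosh_dist_ge_1 [OF g] by simp
  define A B where "A = (c\<^sup>2 + d\<^sup>2 - a\<^sup>2 - b\<^sup>2) / 2" and "B = a * c + b * d"
  define R where "R = sqrt (\<tau>\<^sup>2 - 1)"
  have det: "a * d - b * c = 1" using SL2_D [OF g] by (simp add: abcd)
  have AB: "A\<^sup>2 + B\<^sup>2 = \<tau>\<^sup>2 - 1"
  proof -
    have "4 * (A\<^sup>2 + B\<^sup>2) = 4 * (\<tau>\<^sup>2 - (a * d - b * c)\<^sup>2)"
      unfolding A_def B_def \<tau>_def by (simp add: power2_eq_square field_simps)
    then show ?thesis by (simp add: det)
  qed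
  have R: "R \<ge> 0" "R\<^sup>2 = A\<^sup>2 + B\<^sup>2" using \<tau> by (simp_all add: R_def AB)
  \<comment> \<open>For \<open>R = 0\<close> the form is constant on the circle and any phase
    works.\<close>
  obtain s where s: "0 \<le> s" "s \<le> 2 * pi" "A = R * cos s" "- B = R * sin s"
  proof (cases "R = 0")
    case True
    then have "A = 0" "B = 0" using R(2) by (simp_all add: sum_power2_eq_zero_iff)
    then show ?thesis using True by (intro that [of 0]) auto
  next
    case False
    have "(A / R)\<^sup>2 + (- B / R)\<^sup>2 = (A\<^sup>2 + B\<^sup>2) / R\<^sup>2"
      by (simp add: power_divide add_divide_distrib)
    also have "\<dots> = 1" unfolding R(2) [symmetric] using False by simp
    finally have "(A / R)\<^sup>2 + (- B / R)\<^sup>2 = 1" .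
    from sincos_total_2pi [OF this] obtain s
      where "0 \<le> s" "s < 2 * pi" "A / R = cos s" "- B / R = sin s" by blast
    then show ?thesis using False by (intro that [of s]) (auto simp: field_simps)
  qed
  have q: "qform g t = \<tau> + R * cos (2 * t + s)" for t
  proof -
    have "qform g t = \<tau> * ((sin t)\<^sup>2 + (cos t)\<^sup>2) + A * ((cos t)\<^sup>2 - (sin t)\<^sup>2) + B * (2 * sin t * cos t)"
      unfolding qform_def abcd [symmetric] \<tau>_def A_def B_def
      by (simp add: power2_eq_square field_simps del: sin_cos_squared_add3)
    also have "\<dots> = \<tau> + A * cos (2 * t) + B * sin (2 * t)"
      by (simp add: cos_double sin_double)
    also have "\<dots> = \<tau> + (A * cos (2 * t) - (- B) * sin (2 * t))" by simp
    also have "\<dots> = \<tau> + R * cos (2 * t + s)"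
      unfolding s(3,4) by (simp add: cos_add algebra_simps)
    finally show ?thesis .
  qed
  define f where "f t = complex_of_real (\<tau> + R * cos t) powr \<nu>" for t
  have "f integrable_on {0..2 * pi}"
    unfolding f_def R_def using legendre_base_pos [OF \<tau>]
    by (intro integrable_continuous_real continuous_on_of_real_powr continuous_intros) auto
  moreover have "f (x + 2 * pi) = f x" for x by (simp add: f_def)
  ultimately have "((\<lambda>t. f (2 * t + s)) has_integral integral {0..2 * pi} f) {0..2 * pi}"
    using s(1,2) by (intro has_integral_periodic_double)
  then have "integral {0..2 * pi} (\<lambda>t. of_real (qform g t) powr \<nu>) = integral {0..2 * pi} f"
    by (simp add: f_def q integral_unique)
  then show ?thesis
    by (simp add: legendre_def f_def [abs_def] R_def \<tau>_eq)
qed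

lemma spherical_eq_legendre:
  assumes "g \<in> SL2" "l \<in> a_dual_C"
  shows "spherical l g = legendre (spherical_exponent l) (cosh_dist g)"
  by (simp only: spherical_eq_integral [OF assms] integral_qform_eq_legendre [OF assms(1)])

section \<open>Positive definiteness and expansion along the unipotent subgroup\<close>

text \<open>A curve through the identity on which \<open>qform\<close> is quadratic in
  \<open>x\<close> and inversion is a change of sign.\<close>

definition unip :: "real \<Rightarrow> real ^ 2 ^ 2" where
  "unip x = vector [vector [1, x], vector [0, 1]]"

lemma unip_nth [simp]:
  "unip x $ 1 $ 1 = 1" "unip x $ 1 $ 2 = x" "unip x $ 2 $ 1 = 0" "unip x $ 2 $ 2 = 1"
  by (simp_all add: unip_def)

lemma unip_in_SL2: "unip x \<in> SL2"
  by (simp add: SL2_def det_2)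

lemma unip_mult: "unip x ** unip y = unip (x + y)"
  by (simp add: vec_eq_iff forall_2 matrix_mult_2_nth)

lemma unip_0: "unip 0 = mat 1"
  by (simp add: vec_eq_iff forall_2 mat_def)

lemma matrix_inv_unip: "matrix_inv (unip x) = unip (- x)"
  unfolding matrix_inv_def
proof (rule some_equality)
  fix B assume "unip x ** B = mat 1 \<and> B ** unip x = mat 1"
  then have "unip (- x) = (unip (- x) ** unip x) ** B"
    by (metis matrix_mul_assoc matrix_mul_rid)
  then show "B = unip (- x)" by (simp add: unip_mult unip_0)
qed (simp add: unip_mult unip_0)

text \<open>For the two points \<open>mat 1\<close> and \<open>g\<close>, the coefficients (1, 1)
  give \<open>2 + 2 * f g\<close> and (1, -1) give \<open>2 - 2 * f g\<close>. Both are nonnegative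
  reals, the first making \<open>f g\<close> real and the second bounding it by 1.\<close>

lemma positive_definite_bounded:
  assumes pd: "positive_definite_SL2R f" and g: "g \<in> SL2"
    and one: "f (mat 1) = 1" and inv: "matrix_inv g ** g = mat 1" "f (matrix_inv g) = f g"
  shows "Im (f g) = 0" "Re (f g) \<le> 1"
proof -
  have I: "matrix_inv (mat 1) = (mat 1 :: real^2^2)"
    using matrix_inv_unip [of 0] by (simp add: unip_0)
  have "c 0 * cnj (c 0) + c 0 * cnj (c 1) * f g + (c 1 * cnj (c 0) * f g + c 1 * cnj (c 1)) \<in> \<real>\<^sub>\<ge>\<^sub>0"
    for c :: "nat \<Rightarrow> complex"
  proof -
    define h where "h i = (if i = 0 then mat 1 else g)" for i :: nat
    have "\<forall>i<2. h i \<in> SL2"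
      using g unip_in_SL2 [of 0] by (simp add: h_def unip_0)
    with pd have "(\<Sum>i<2. \<Sum>j<2. c i * cnj (c j) * f (matrix_inv (h j) ** h i)) \<in> \<real>\<^sub>\<ge>\<^sub>0"
      unfolding positive_definite_SL2R_def by blast
    then show ?thesis
      by (simp add: h_def numeral_2_eq_2 lessThan_Suc I one inv algebra_simps)
  qed
  from this [of "\<lambda>i. 1"] this [of "\<lambda>i. if i = 0 then 1 else - 1"]
  show "Im (f g) = 0" "Re (f g) \<le> 1"
    by (auto simp: complex_nonneg_Reals_iff)
qed

lemma powr_Taylor_2:
  fixes \<nu> :: complex
  obtains C where "C \<ge> 0"
    "\<And>u::real. \<bar>u - 1\<bar> \<le> 1/2 \<Longrightarrow> cmod (of_real u powr \<nu> - (1 + \<nu> * of_real (u - 1) + \<nu> * (\<nu> - 1) / 2 * of_real ((u - 1)\<^sup>2))) \<le> C * \<bar>u - 1\<bar> ^ 3"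
proof -
  define S where "S = cball (1::complex) (1/2)"
  \<comment> \<open>The \<open>i\<close>-th derivative of the principal power with exponent \<nu>.
    The closed disc \<open>S\<close> lies in the right half-plane, away from the branch cut, and
    compactness bounds the third derivative.\<close>
  define f where "f i z = (\<Prod>j<i. \<nu> - of_nat j) * z powr (\<nu> - of_nat i)" for i z
  have Re: "Re z > 0" if "z \<in> S" for z
    using that abs_Re_le_cmod [of "1 - z"] by (auto simp: S_def dist_norm)
  then have S: "z \<notin> \<real>\<^sub>\<le>\<^sub>0" if "z \<in> S" for z
    using that by (force simp: complex_nonpos_Reals_iff)
  have der: "(f i has_field_derivative f (Suc i) z) (at z within S)" if "z \<in> S" for i z
    unfolding f_def using S [OF that]
    by (auto intro!: derivative_eq_intros simp: algebra_simps)
  have "continuous_on S (f 3)"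
    unfolding continuous_on_eq_continuous_within by (meson DERIV_continuous der)
  moreover have "compact S" by (simp add: S_def)
  ultimately have "bounded (f 3 ` S)" by (intro compact_imp_bounded compact_continuous_image)
  then obtain B where B: "\<And>z. z \<in> S \<Longrightarrow> cmod (f 3 z) \<le> B" "B > 0"
    by (auto simp: bounded_pos)
  show thesis
  \<comment> \<open>The remainder in \<open>complex_Taylor\<close> is divided by
    \<open>fact 2\<close>, not \<open>fact 3\<close>.\<close>
  proof (rule that [of "B / 2"])
    fix u :: real assume u: "\<bar>u - 1\<bar> \<le> 1/2"
    have n: "cmod (of_real u - 1) = \<bar>u - 1\<bar>"
      by (metis norm_of_real of_real_1 of_real_diff)
    then have "of_real u \<in> S"
      using u by (simp add: S_def dist_norm norm_minus_commute)
    then have "cmod (f 0 (of_real u) - (\<Sum>i\<le>2. f i 1 * (of_real u - 1) ^ i / fact i))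
        \<le> B * cmod (of_real u - 1) ^ Suc 2 / fact 2"
      using B(1) der by (intro complex_Taylor [where S = S]) (simp_all, simp_all add: S_def)
    moreover have "f 0 (of_real u) = of_real u powr \<nu>" by (simp add: f_def)
    moreover have "(\<Sum>i\<le>2. f i 1 * (of_real u - 1) ^ i / fact i)
        = 1 + \<nu> * of_real (u - 1) + \<nu> * (\<nu> - 1) / 2 * of_real ((u - 1)\<^sup>2)"
      by (simp add: f_def numeral_2_eq_2 lessThan_Suc atMost_Suc)
    ultimately show "cmod (of_real u powr \<nu> - (1 + \<nu> * of_real (u - 1) + \<nu> * (\<nu> - 1) / 2 * of_real ((u - 1)\<^sup>2)))
        \<le> B / 2 * \<bar>u - 1\<bar> ^ 3"
      by (simp add: n numeral_3_eq_3)
  qed (use B in auto)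
qed

lemma has_integral_sin_terms:
  "((\<lambda>t. sin (2 * t)) has_integral 0) {0..2 * pi}"
  "((\<lambda>t. (sin t)\<^sup>2) has_integral pi) {0..2 * pi}"
  "((\<lambda>t. (sin (2 * t))\<^sup>2) has_integral pi) {0..2 * pi}"
proof -
  have "((\<lambda>t. sin (2 * t)) has_integral (- cos (2 * (2 * pi)) / 2 - - cos (2 * 0) / 2)) {0..2 * pi}"
    by (rule fundamental_theorem_of_calculus)
       (auto intro!: derivative_eq_intros simp flip: has_real_derivative_iff_has_vector_derivative)
  moreover have "cos (2 * (2 * pi)) = 1" using cos_int_2pin [of 2] by (simp add: mult.commute)
  ultimately show "((\<lambda>t. sin (2 * t)) has_integral 0) {0..2 * pi}" by simp
  have *: "((\<lambda>t. (sin t)\<^sup>2) has_integral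
      ((2 * pi - sin (2 * pi) * cos (2 * pi)) / 2 - (0 - sin 0 * cos 0) / 2)) {0..2 * pi}"
  proof (rule fundamental_theorem_of_calculus)
    fix t :: real
    have "((\<lambda>t. (t - sin t * cos t) / 2) has_real_derivative (1 - ((cos t)\<^sup>2 - (sin t)\<^sup>2)) / 2)
        (at t within {0..2 * pi})"
      by (auto intro!: derivative_eq_intros simp: power2_eq_square)
    then show "((\<lambda>t. (t - sin t * cos t) / 2) has_vector_derivative (sin t)\<^sup>2) (at t within {0..2 * pi})"
      unfolding has_real_derivative_iff_has_vector_derivative [symmetric]
      by (simp add: cos_squared_eq)
  qed simp
  then show s2: "((\<lambda>t. (sin t)\<^sup>2) has_integral pi) {0..2 * pi}" by simp
  have "((\<lambda>t. (sin (2 * t + 0))\<^sup>2) has_integral integral {0..2 * pi} (\<lambda>t. (sin t)\<^sup>2)) {0..2 * pi}"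
    using s2 by (intro has_integral_periodic_double) auto
  then show "((\<lambda>t. (sin (2 * t))\<^sup>2) has_integral pi) {0..2 * pi}"
    using s2 by (simp add: integral_unique)
qed

text \<open>Here \<open>qform (unip x) t\<close> is
  \<open>1 + x * sin (2 * t) + x\<^sup>2 * (sin t)\<^sup>2\<close>. In the Taylor expansion of its
  power the linear term averages to 0, while both squared sines average to 1/2, so the coefficient
  of \<open>x\<^sup>2\<close> is \<nu>/2 + \<nu>(\<nu> - 1)/4.\<close>

lemma spherical_unip_expansion:
  assumes l: "l \<in> a_dual_C"
  defines "\<nu> \<equiv> spherical_exponent l"
  shows "((\<lambda>x. (spherical l (unip x) - 1) / of_real (x\<^sup>2)) \<longlongrightarrow> (\<nu>\<^sup>2 + \<nu>) / 4) (at_right 0)"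
proof -
  obtain C where C: "C \<ge> 0"
    "\<And>u::real. \<bar>u - 1\<bar> \<le> 1/2 \<Longrightarrow> cmod (of_real u powr \<nu> - (1 + \<nu> * of_real (u - 1) + \<nu> * (\<nu> - 1) / 2 * of_real ((u - 1)\<^sup>2))) \<le> C * \<bar>u - 1\<bar> ^ 3"
    using powr_Taylor_2 [of \<nu>] by blast
  \<comment> \<open>The 8 comes from cubing \<open>\<bar>u - 1\<bar> \<le> 2 * x\<close>, where
    \<open>x \<le> 1/4\<close> keeps \<open>u\<close> in the Taylor range; the 3 bounds the cubic
    and quartic terms of \<open>(u - 1)\<^sup>2\<close>, divided by \<open>x ^ 3\<close>.\<close>
  define D where "D = C * 8 + cmod (\<nu> * (\<nu> - 1) / 2) * 3"
  have bound: "cmod ((spherical l (unip x) - 1) / of_real (x\<^sup>2) - (\<nu>\<^sup>2 + \<nu>) / 4) \<le> D * x"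
    if x: "0 < x" "x \<le> 1/4" for x
  proof -
    let ?s = "\<lambda>t. sin (2 * t)" and ?r = "\<lambda>t::real. (sin t)\<^sup>2"
    \<comment> \<open>The Taylor polynomial with all powers of \<open>x\<close> beyond the second
      dropped.\<close>
    define M where "M t = 1 + \<nu> * of_real (x * ?s t + x\<^sup>2 * ?r t) + \<nu> * (\<nu> - 1) / 2 * of_real (x\<^sup>2 * (?s t)\<^sup>2)" for t
    define h where "h t = complex_of_real (qform (unip x) t) powr \<nu>" for t
    have "((\<lambda>t. 1 + \<nu> * of_real (x * ?s t + x\<^sup>2 * ?r t) + \<nu> * (\<nu> - 1) / 2 * of_real (x\<^sup>2 * (?s t)\<^sup>2))
       has_integral (of_real (2 * pi) + \<nu> * of_real (x * 0 + x\<^sup>2 * pi) + \<nu> * (\<nu> - 1) / 2 * of_real (x\<^sup>2 * pi))) {0..2 * pi}"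
      using has_integral_const_real [of "1::complex" 0 "2 * pi"]
      by (intro has_integral_add has_integral_mult_right has_integral_of_real has_integral_sin_terms)
         (simp add: scaleR_conv_of_real)
    then have M: "(M has_integral of_real (2 * pi) * (1 + of_real (x\<^sup>2) * ((\<nu>\<^sup>2 + \<nu>) / 4))) {0..2 * pi}"
      unfolding M_def by (rule has_integral_eq_rhs) (simp add: power2_eq_square field_simps)
    have hcont: "continuous_on {0..2 * pi} h"
      unfolding h_def using qform_pos [OF unip_in_SL2]
      by (intro continuous_on_of_real_powr) (auto simp: qform_def intro!: continuous_intros)
    then have hint: "h integrable_on {0..2 * pi}"
      by (rule integrable_continuous_real)
    have Mcont: "continuous_on {0..2 * pi} M"
      unfolding M_def by (intro continuous_intros)
    have le: "cmod (h t - M t) \<le> D * x ^ 3" for t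
    proof -
      define u where "u = qform (unip x) t"
      have "u = ((sin t)\<^sup>2 + (cos t)\<^sup>2) + x * (2 * sin t * cos t) + x\<^sup>2 * (sin t)\<^sup>2"
        unfolding u_def qform_def by (simp add: power2_eq_square algebra_simps del: sin_cos_squared_add3)
      then have u: "u - 1 = x * ?s t + x\<^sup>2 * ?r t" by (simp add: sin_double)
      have sr: "\<bar>?s t\<bar> \<le> 1" "0 \<le> ?r t" "?r t \<le> 1" by (auto simp: abs_square_le_1)
      have le2x: "\<bar>p + q\<bar> \<le> 2 * x" if "\<bar>p\<bar> \<le> x" "0 \<le> q" "q \<le> x" for p q :: real
        using that by linarith
      have "\<bar>x * ?s t\<bar> \<le> x" using sr x by (simp add: abs_mult mult_left_le)
      moreover have "x\<^sup>2 * ?r t \<le> x * 1"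
        unfolding power2_eq_square mult.assoc
        using sr x by (intro mult_left_mono) (auto simp: power2_eq_square mult_le_one)
      moreover have "0 \<le> x\<^sup>2 * ?r t" by simp
      ultimately have ule: "\<bar>u - 1\<bar> \<le> 2 * x"
        unfolding u by (intro le2x) simp_all
      have "\<bar>u - 1\<bar> ^ 3 \<le> (2 * x) ^ 3" by (rule power_mono [OF ule]) simp
      then have 1: "C * \<bar>u - 1\<bar> ^ 3 \<le> C * 8 * x ^ 3"
        using mult_left_mono [OF _ C(1), of "\<bar>u - 1\<bar> ^ 3" "(2 * x) ^ 3"]
        by (simp add: power_mult_distrib)
      have "(u - 1)\<^sup>2 - x\<^sup>2 * (?s t)\<^sup>2 = x ^ 3 * (2 * ?s t * ?r t + x * (?r t)\<^sup>2)"
        unfolding u by (simp add: power2_eq_square power3_eq_cube algebra_simps)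
      moreover have "\<bar>2 * ?s t * ?r t + x * (?r t)\<^sup>2\<bar> \<le> 3"
      proof -
        have r2: "(?r t)\<^sup>2 \<le> 1" using sr(2,3) by (rule power_le_one)
        have "\<bar>?s t\<bar> * ?r t \<le> 1 * 1" using sr by (intro mult_mono) simp_all
        then have "\<bar>2 * ?s t * ?r t\<bar> \<le> 2" by (simp add: abs_mult)
        moreover have "\<bar>x * (?r t)\<^sup>2\<bar> \<le> 1 * 1"
          unfolding abs_mult using r2 x by (intro mult_mono) simp_all
        ultimately show ?thesis by linarith
      qed
      ultimately have 2: "\<bar>(u - 1)\<^sup>2 - x\<^sup>2 * (?s t)\<^sup>2\<bar> \<le> x ^ 3 * 3"
        using x by (simp add: abs_mult)
      have "h t - M t = (of_real u powr \<nu> - (1 + \<nu> * of_real (u - 1) + \<nu> * (\<nu> - 1) / 2 * of_real ((u - 1)\<^sup>2)))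
          + \<nu> * (\<nu> - 1) / 2 * of_real ((u - 1)\<^sup>2 - x\<^sup>2 * (?s t)\<^sup>2)"
        unfolding h_def M_def u [symmetric] u_def [symmetric] of_real_diff [of _ "x\<^sup>2 * (?s t)\<^sup>2"]
        by (simp only: right_diff_distrib) simp
      also have "cmod \<dots> \<le> C * \<bar>u - 1\<bar> ^ 3 + cmod (\<nu> * (\<nu> - 1) / 2) * \<bar>(u - 1)\<^sup>2 - x\<^sup>2 * (?s t)\<^sup>2\<bar>"
        using ule x by (intro order.trans [OF norm_triangle_ineq] add_mono C(2))
          (simp_all only: norm_mult norm_of_real order.refl)
      also have "\<dots> \<le> C * 8 * x ^ 3 + cmod (\<nu> * (\<nu> - 1) / 2) * (x ^ 3 * 3)"
        by (intro add_mono 1 mult_left_mono 2) auto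
      finally show ?thesis by (simp add: D_def algebra_simps)
    qed
    define W where "W = spherical l (unip x) - (1 + of_real (x\<^sup>2) * ((\<nu>\<^sup>2 + \<nu>) / 4))"
    define E where "E = integral {0..2 * pi} (\<lambda>t. h t - M t)"
    have E_le: "cmod E \<le> D * x ^ 3 * (2 * pi - 0)"
      unfolding E_def using le by (intro integral_bound continuous_on_diff hcont Mcont) auto
    have E_eq: "E = of_real (2 * pi) * W"
    proof -
      have "E = integral {0..2 * pi} h - of_real (2 * pi) * (1 + of_real (x\<^sup>2) * ((\<nu>\<^sup>2 + \<nu>) / 4))"
        unfolding E_def using M hint by (simp add: Henstock_Kurzweil_Integration.integral_diff has_integral_integrable integral_unique)
      moreover have "integral {0..2 * pi} h = of_real (2 * pi) * spherical l (unip x)"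
        by (simp add: spherical_eq_integral [OF unip_in_SL2 l] h_def [abs_def] flip: \<nu>_def)
      ultimately show ?thesis unfolding W_def by (simp only: right_diff_distrib)
    qed
    have "2 * pi * cmod W \<le> 2 * pi * (D * x ^ 3)"
      using E_le unfolding E_eq by (simp add: norm_mult mult_ac)
    then have "cmod W \<le> D * x ^ 3"
      by (rule mult_left_le_imp_le) simp
    moreover have "(spherical l (unip x) - 1) / of_real (x\<^sup>2) - (\<nu>\<^sup>2 + \<nu>) / 4
        = W / of_real (x\<^sup>2)"
      using x by (simp add: W_def diff_divide_distrib add_divide_distrib)
    moreover have "cmod (W / of_real (x\<^sup>2)) = cmod W / x\<^sup>2"
      by (simp only: norm_divide norm_of_real abs_power2)
    moreover have "cmod W / x\<^sup>2 \<le> D * x"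
      using \<open>cmod W \<le> D * x ^ 3\<close> x by (simp add: divide_simps power2_eq_square power3_eq_cube mult_ac)
    ultimately show ?thesis by simp
  qed
  show ?thesis
  proof (rule LIM_zero_cancel, rule Lim_null_comparison)
    show "\<forall>\<^sub>F x in at_right 0. norm ((spherical l (unip x) - 1) / of_real (x\<^sup>2) - (\<nu>\<^sup>2 + \<nu>) / 4) \<le> D * x"
      unfolding eventually_at_right_field using bound by (intro exI [of _ "1/4"]) auto
    show "((\<lambda>x. D * x) \<longlongrightarrow> 0) (at_right 0)"
      by (auto intro!: tendsto_eq_intros)
  qed
qed

text \<open>The difference quotients lie in the closed ray of nonpositive reals, hence so does
  (\<nu>^2 + \<nu>)/4. Vanishing of its imaginary part leaves real \<nu>, where \<nu>(\<nu> + 1)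
  \<le> 0 gives the interval from -1 to 0, or real part -1/2.\<close>

lemma pos_def_params_exponent:
  assumes "l \<in> pos_def_params"
  shows "- 1 \<le> Re (spherical_exponent l)" "Re (spherical_exponent l) \<le> 0"
proof -
  define \<nu> where "\<nu> = spherical_exponent l"
  have l: "l \<in> a_dual_C" and pd: "positive_definite_SL2R (spherical l)"
    using assms by (auto simp: pos_def_params_def)
  have one: "spherical l (mat 1) = 1"
    using spherical_eq_integral [OF unip_in_SL2 [of 0] l] integral_const_real [of 0 "2 * pi" "1::complex"]
    by (simp add: qform_def scaleR_conv_of_real flip: unip_0)
  \<comment> \<open>Invariance under inversion holds because \<open>cosh_dist\<close> takes the same
    value at \<open>unip x\<close> and \<open>unip (- x)\<close>.\<close>
  have P: "Im (spherical l (unip x)) = 0" "Re (spherical l (unip x)) \<le> 1" for x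
    by (rule positive_definite_bounded [OF pd unip_in_SL2 one];
        simp add: matrix_inv_unip unip_mult unip_0 cosh_dist_def spherical_eq_legendre [OF unip_in_SL2 l])+
  define T where "T = {z::complex. Im z = 0} \<inter> {z. Re z \<le> 0}"
  have "closed T"
    unfolding T_def by (intro closed_Int closed_Collect_eq closed_Collect_le continuous_intros)
  moreover have "(spherical l (unip x) - 1) / of_real (x\<^sup>2) \<in> T" for x
    using P by (simp add: T_def Re_divide_of_real Im_divide_of_real divide_le_0_iff)
  ultimately have "(\<nu>\<^sup>2 + \<nu>) / 4 \<in> T"
    by (intro Lim_in_closed_set [OF _ _ _ spherical_unip_expansion [OF l, folded \<nu>_def]]) auto
  then have im: "Im \<nu> * (2 * Re \<nu> + 1) = 0" and re: "(Re \<nu>)\<^sup>2 - (Im \<nu>)\<^sup>2 + Re \<nu> \<le> 0"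
    by (simp_all add: T_def power2_eq_square algebra_simps)
  have "Re \<nu> * (Re \<nu> + 1) \<le> 0" if "Im \<nu> = 0"
    using re that by (simp add: power2_eq_square algebra_simps)
  then have "- 1 \<le> Re \<nu> \<and> Re \<nu> \<le> 0"
    using im by (cases "Im \<nu> = 0") (auto simp: mult_le_0_iff)
  then show "- 1 \<le> Re (spherical_exponent l)" "Re (spherical_exponent l) \<le> 0"
    by (simp_all add: \<nu>_def)
qed

section \<open>The integral formula on the crown\<close>

text \<open>The squared length of \<open>(sin t, cos t)\<close> times
  \<open>g ** diag2 (exp z) (exp (- z))\<close>, with squares of the coordinates in place of squared
  moduli, so that it is holomorphic in \<open>z\<close>.\<close>

definition cform :: "real ^ 2 ^ 2 \<Rightarrow> complex \<Rightarrow> real \<Rightarrow> complex" where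
  "cform g z t = of_real ((sin t * g $ 1 $ 1 + cos t * g $ 2 $ 1)\<^sup>2) * exp (2 * z)
     + of_real ((sin t * g $ 1 $ 2 + cos t * g $ 2 $ 2)\<^sup>2) * exp (- 2 * z)"

definition crown_strip :: "complex set" where
  "crown_strip = {z. \<bar>Im z\<bar> < pi / 4}"

text \<open>The width of the crown enters here: both exponentials have real part a positive multiple
  of \<open>cos (2 * Im z)\<close>, and \<open>\<bar>2 * Im z\<bar> < pi / 2\<close>.\<close>

lemma cform_Re_pos:
  assumes g: "g \<in> SL2" and z: "z \<in> crown_strip"
  shows "Re (cform g z t) > 0"
proof -
  define x y where "x = sin t * g $ 1 $ 1 + cos t * g $ 2 $ 1" and "y = sin t * g $ 1 $ 2 + cos t * g $ 2 $ 2"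
  have "x\<^sup>2 + y\<^sup>2 > 0" using qform_pos [OF g, of t] by (simp add: qform_def x_def y_def)
  then have "x\<^sup>2 * exp (2 * Re z) + y\<^sup>2 * exp (- 2 * Re z) > 0"
    by (cases "x = 0") (auto intro!: add_pos_nonneg)
  moreover have "cos (2 * Im z) > 0"
    using z by (intro cos_gt_zero_pi) (auto simp: crown_strip_def abs_less_iff)
  moreover have "Re (cform g z t) = (x\<^sup>2 * exp (2 * Re z) + y\<^sup>2 * exp (- 2 * Re z)) * cos (2 * Im z)"
    by (simp add: cform_def Re_exp distrib_right mult.assoc flip: x_def y_def)
  ultimately show ?thesis by simp
qed

lemma cform_not_nonpos:
  "g \<in> SL2 \<Longrightarrow> z \<in> crown_strip \<Longrightarrow> cform g z t \<notin> \<real>\<^sub>\<le>\<^sub>0"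
  using cform_Re_pos [of g z t] by (auto simp: complex_nonpos_Reals_iff)

lemma crown_strip_open: "open crown_strip"
  unfolding crown_strip_def by (intro open_Collect_less continuous_intros)

lemma crown_strip_convex: "convex crown_strip"
proof -
  have "crown_strip = {z. Im z < pi / 4} \<inter> {z. Im z > - (pi / 4)}"
    by (auto simp: crown_strip_def)
  then show ?thesis
    by (metis convex_Int convex_halfspace_Im_lt convex_halfspace_Im_gt)
qed

text \<open>Letting both arguments vary covers continuity in \<open>t\<close> for fixed
  \<open>z\<close> as well as the joint continuity needed to differentiate under the
  integral.\<close>

lemma continuous_on_cform_powr:
  fixes h :: "'a::t2_space \<Rightarrow> real"
  assumes g: "g \<in> SL2" and f: "continuous_on S f" "\<And>x. x \<in> S \<Longrightarrow> f x \<in> crown_strip"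
    and h: "continuous_on S h"
  shows "continuous_on S (\<lambda>x. cform g (f x) (h x) powr \<nu>)"
proof (rule continuous_on_powr_complex)
  have pos: "Re (cform g (f x) (h x)) > 0" if "x \<in> S" for x
    by (rule cform_Re_pos [OF g f(2) [OF that]])
  then show "S \<subseteq> {x. 0 \<le> Re (cform g (f x) (h x)) \<or> Im (cform g (f x) (h x)) \<noteq> 0}"
    by (auto intro: less_imp_le)
  show "Re \<nu> > 0" if "x \<in> S" "cform g (f x) (h x) = 0" for x
    using pos [OF that(1)] that(2) by simp
  show "continuous_on S (\<lambda>x. cform g (f x) (h x))"
    unfolding cform_def by (intro continuous_intros f(1) h)
qed (rule continuous_on_const)

lemma holomorphic_integral_cform:
  assumes g: "g \<in> SL2"
  shows "(\<lambda>z. integral {0..2 * pi} (\<lambda>t. cform g z t powr \<nu>)) holomorphic_on crown_strip"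
proof -
  define c' where "c' z t = of_real ((sin t * g $ 1 $ 1 + cos t * g $ 2 $ 1)\<^sup>2) * (2 * exp (2 * z))
     - of_real ((sin t * g $ 1 $ 2 + cos t * g $ 2 $ 2)\<^sup>2) * (2 * exp (- 2 * z))" for z :: complex and t
  have "(\<lambda>z. integral (cbox 0 (2 * pi)) (\<lambda>t. cform g z t powr \<nu>)) holomorphic_on crown_strip"
  proof (rule leibniz_rule_holomorphic)
    fix z t assume z: "z \<in> crown_strip"
    have "((\<lambda>z. cform g z t) has_field_derivative c' z t) (at z within crown_strip)"
      unfolding cform_def c'_def by (auto intro!: derivative_eq_intros)
    then show "((\<lambda>z. cform g z t powr \<nu>) has_field_derivative \<nu> * cform g z t powr (\<nu> - 1) * c' z t)
        (at z within crown_strip)"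
      using cform_not_nonpos [OF g z, of t] by (auto intro!: derivative_eq_intros)
  next
    fix z assume "z \<in> crown_strip"
    then show "(\<lambda>t. cform g z t powr \<nu>) integrable_on cbox 0 (2 * pi)"
      by (intro integrable_continuous continuous_on_cform_powr g continuous_intros)
  next
    have "continuous_on (crown_strip \<times> cbox 0 (2 * pi))
        (\<lambda>x. \<nu> * cform g (fst x) (snd x) powr (\<nu> - 1) * c' (fst x) (snd x))"
      unfolding c'_def by (intro continuous_intros continuous_on_cform_powr g) auto
    then show "continuous_on (crown_strip \<times> cbox 0 (2 * pi))
        (\<lambda>(z, t). \<nu> * cform g z t powr (\<nu> - 1) * c' z t)"
      by (simp add: case_prod_beta)
  qed (rule crown_strip_convex)
  then show ?thesis by simp
qed

lemma cform_of_real: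
  "cform g (of_real s) t = of_real (qform (g ** diag2 (exp s) (exp (- s))) t)"
proof -
  have "exp (2 * complex_of_real s) = (of_real (exp s))\<^sup>2" "exp (- 2 * complex_of_real s) = (of_real (exp (- s)))\<^sup>2"
    by (simp_all add: exp_of_real [symmetric] exp_double [symmetric])
  moreover have "qform (g ** diag2 (exp s) (exp (- s))) t
      = (sin t * g $ 1 $ 1 + cos t * g $ 2 $ 1)\<^sup>2 * (exp s)\<^sup>2
      + (sin t * g $ 1 $ 2 + cos t * g $ 2 $ 2)\<^sup>2 * (exp (- s))\<^sup>2"
    by (simp add: qform_def matrix_mult_2_nth power_mult_distrib [symmetric] distrib_right mult.assoc)
  ultimately show ?thesis
    by (simp only: cform_def of_real_add of_real_mult of_real_power)
qed

text \<open>The two linear factors come from \<open>X\<^sup>2 + Y\<^sup>2 = (X + \<i>Y) (X - \<i>Y)\<close>; their determinant is \<open>-2\<i> det g\<close>.\<close>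

lemma integral_inverse_sqrt_cform_le:
  assumes g: "g \<in> SL2" and s: "\<i> * of_real s \<in> crown_strip"
  shows "integral {0..2 * pi} (\<lambda>t. 1 / sqrt (cmod (cform g (\<i> * of_real s) t)))
    \<le> 2 * integral {0..2 * pi} (\<lambda>t. 1 / sqrt \<bar>sin t\<bar>)"
proof -
  define a b c d where abcd: "a = complex_of_real (g $ 1 $ 1)" "b = complex_of_real (g $ 1 $ 2)"
    "c = complex_of_real (g $ 2 $ 1)" "d = complex_of_real (g $ 2 $ 2)"
  define e e' where "e = exp (\<i> * of_real s)" and "e' = exp (- (\<i> * of_real s))"
  have ee: "e * e' = 1" by (simp add: e_def e'_def flip: exp_add)
  have sq: "exp (2 * (\<i> * of_real s)) = e\<^sup>2" "exp (- 2 * (\<i> * of_real s)) = e'\<^sup>2"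
    by (simp_all add: e_def e'_def flip: exp_double)
  have "a * d - b * c = of_real (g $ 1 $ 1 * g $ 2 $ 2 - g $ 1 $ 2 * g $ 2 $ 1)"
    by (simp add: abcd)
  then have det: "a * d - b * c = 1" by (simp only: SL2_D [OF g] of_real_1)
  have fac: "cform g (\<i> * of_real s) t =
     ((a * e + \<i> * b * e') * of_real (sin t) + (c * e + \<i> * d * e') * of_real (cos t)) *
     ((a * e - \<i> * b * e') * of_real (sin t) + (c * e - \<i> * d * e') * of_real (cos t))" for t
  proof -
    have *: "X\<^sup>2 * e\<^sup>2 + Y\<^sup>2 * e'\<^sup>2 = (X * e + \<i> * (Y * e')) * (X * e - \<i> * (Y * e'))" for X Y
      by (simp add: power2_eq_square algebra_simps)
    show ?thesis
      unfolding cform_def sq abcd of_real_power of_real_add of_real_mult *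
      by (simp add: algebra_simps)
  qed
  have "(a * e + \<i> * b * e') * (c * e - \<i> * d * e') - (a * e - \<i> * b * e') * (c * e + \<i> * d * e')
      = - 2 * \<i> * (a * d - b * c) * (e * e')"
    by (simp add: algebra_simps)
  then have "cmod ((a * e + \<i> * b * e') * (c * e - \<i> * d * e') - (a * e - \<i> * b * e') * (c * e + \<i> * d * e')) = 2"
    by (simp only: det ee) (simp add: norm_mult)
  moreover have "cform g (\<i> * of_real s) t \<noteq> 0" for t
    using cform_not_nonpos [OF g s, of t] by auto
  ultimately show ?thesis
    unfolding fac by (rule integral_inverse_sqrt_form_le)
qed

text \<open>The lower bound -1/2 on the exponent makes one integrable majorant serve for all
  exponents: 1 dominates for large \<open>r\<close>, the inverse square root for small
  \<open>r\<close>.\<close>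

lemma powr_half_le:
  fixes r a :: real
  assumes "r > 0" "-1/2 \<le> a" "a \<le> 0"
  shows "r powr a \<le> 1 + 1 / sqrt r"
proof (cases "r \<ge> 1")
  case True
  then have "r powr a \<le> r powr 0" using assms by (intro powr_mono)
  then show ?thesis using True by (simp add: add_increasing2)
next
  case False
  then have "r powr a \<le> r powr (- (1/2))" using assms by (intro powr_mono') auto
  also have "\<dots> = 1 / sqrt r" using assms by (simp add: powr_minus_divide powr_half_sqrt)
  finally show ?thesis by simp
qed

text \<open>The modulus of the power is \<open>cmod (Q t) powr Re \<nu>\<close> times
  \<open>exp (- Im \<nu> * Arg (Q t))\<close>, and the argument is at most \<open>pi\<close> in
  modulus. The resulting bound depends on neither \<open>g\<close> nor \<open>s\<close>.\<close>

lemma integral_cform_powr_le: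
  assumes g: "g \<in> SL2" and s: "\<i> * of_real s \<in> crown_strip"
    and \<nu>: "-1/2 \<le> Re \<nu>" "Re \<nu> \<le> 0"
  shows "cmod (integral {0..2 * pi} (\<lambda>t. cform g (\<i> * of_real s) t powr \<nu>))
    \<le> exp (pi * \<bar>Im \<nu>\<bar>) * (2 * pi + 2 * integral {0..2 * pi} (\<lambda>t. 1 / sqrt \<bar>sin t\<bar>))"
proof -
  define Q where "Q = cform g (\<i> * of_real s)"
  have nz: "Q t \<noteq> 0" for t using cform_not_nonpos [OF g s, of t] by (auto simp: Q_def)
  have Qcont: "continuous_on S Q" for S
    unfolding Q_def cform_def by (intro continuous_intros)
  then have fint: "(\<lambda>t. 1 / sqrt (cmod (Q t))) integrable_on {0..2 * pi}"
    using nz by (intro integrable_continuous_real continuous_intros) auto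
  have bound: "cmod (Q t powr \<nu>) \<le> exp (pi * \<bar>Im \<nu>\<bar>) * (1 + 1 / sqrt (cmod (Q t)))" for t
  proof -
    have "- Im \<nu> * Arg (Q t) \<le> \<bar>Im \<nu>\<bar> * \<bar>Arg (Q t)\<bar>"
      by (metis abs_ge_self abs_minus_cancel abs_mult)
    also have "\<dots> \<le> \<bar>Im \<nu>\<bar> * pi"
      using Arg_bounded [of "Q t"] by (intro mult_left_mono) (auto simp: abs_le_iff)
    finally have "exp (- Im \<nu> * Arg (Q t)) \<le> exp (pi * \<bar>Im \<nu>\<bar>)" by (simp add: mult.commute)
    moreover have "cmod (Q t) powr Re \<nu> \<le> 1 + 1 / sqrt (cmod (Q t))"
      using nz \<nu> by (intro powr_half_le) auto
    ultimately show ?thesis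
      unfolding norm_powr_complex by (subst mult.commute) (intro mult_mono, auto)
  qed
  have "cmod (integral {0..2 * pi} (\<lambda>t. Q t powr \<nu>))
      \<le> integral {0..2 * pi} (\<lambda>t. exp (pi * \<bar>Im \<nu>\<bar>) * (1 + 1 / sqrt (cmod (Q t))))"
  proof (rule integral_norm_bound_integral)
    show "(\<lambda>t. Q t powr \<nu>) integrable_on {0..2 * pi}"
      unfolding Q_def using s
      by (intro integrable_continuous_real continuous_on_cform_powr g continuous_intros)
    show "(\<lambda>t. exp (pi * \<bar>Im \<nu>\<bar>) * (1 + 1 / sqrt (cmod (Q t)))) integrable_on {0..2 * pi}"
      using fint by (intro integrable_on_mult_right integrable_add) auto
  qed (rule bound)
  also have "\<dots> = exp (pi * \<bar>Im \<nu>\<bar>) * (2 * pi + integral {0..2 * pi} (\<lambda>t. 1 / sqrt (cmod (Q t))))"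
    using fint by (subst integral_mult_right, subst Henstock_Kurzweil_Integration.integral_add) auto
  also have "\<dots> \<le> exp (pi * \<bar>Im \<nu>\<bar>) * (2 * pi + 2 * integral {0..2 * pi} (\<lambda>t. 1 / sqrt \<bar>sin t\<bar>))"
    unfolding Q_def by (intro mult_left_mono add_left_mono integral_inverse_sqrt_cform_le g s) auto
  finally show ?thesis by (simp add: Q_def)
qed

section \<open>The holomorphic extension\<close>

definition crown_curve :: "real ^ 2 ^ 2 \<Rightarrow> complex \<Rightarrow> complex ^ 2 ^ 2" where
  "crown_curve g z = complexify g ** diag2 (exp z) (exp (- z))"

lemma crown_curve_of_real:
  "crown_curve g (of_real s) = complexify (g ** diag2 (exp s) (exp (- s)))"
  by (simp add: crown_curve_def vec_eq_iff forall_2 matrix_mult_2_nth exp_of_real flip: of_real_minus)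

lemma diag2_exp_in_SL2: "diag2 (exp s) (exp (- s)) \<in> SL2" for s :: "'a::{banach,real_normed_field}"
  by (simp add: SL2_def det_2 flip: exp_add)

lemma crown_curve_in_SL2:
  assumes "g \<in> SL2"
  shows "crown_curve g z \<in> SL2"
proof -
  have "complexify g \<in> SL2"
    using SL2_D [OF assms] by (simp add: SL2_def det_2 flip: of_real_mult of_real_diff)
  then show ?thesis
    unfolding crown_curve_def by (intro SL2_mult diag2_exp_in_SL2)
qed

text \<open>The real part of \<open>z\<close> is absorbed into the real matrix \<open>h\<close>;
  only the imaginary part remains for \<open>crown_Omega\<close>.\<close>

lemma coset_crown_curve_in_crown:
  assumes g: "g \<in> SL2" and z: "z \<in> crown_strip"
  shows "coset_KC (crown_curve g z) \<in> crown"
proof -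
  define X where "X = diag2 (Im z) (- Im z)"
  define h where "h = g ** diag2 (exp (Re z)) (exp (- Re z))"
  have "exp z = of_real (exp (Re z)) * exp (\<i> * of_real (Im z))"
    by (simp add: exp_eq_polar [of z] cis_conv_exp)
  moreover have "exp (- z) = of_real (exp (- Re z)) * exp (\<i> * of_real (- Im z))"
    by (simp add: exp_eq_polar [of "- z"] cis_conv_exp)
  ultimately have "crown_curve g z = complexify h ** exp_diag (map_matrix (\<lambda>x. \<i> * complex_of_real x) X)"
    by (simp add: crown_curve_def h_def X_def exp_diag_def vec_eq_iff forall_2 matrix_mult_2_nth mult.assoc)
  moreover have "h \<in> SL2" unfolding h_def by (intro SL2_mult g diag2_exp_in_SL2)
  moreover have "X \<in> crown_Omega"
    using z by (auto simp: crown_Omega_def X_def lie_a_def root_alpha_def crown_strip_def)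
  ultimately show ?thesis
    unfolding crown_def mem_Collect_eq by (intro exI [of _ h] exI [of _ X] conjI) simp_all
qed

lemma crown_imp_crown_curve:
  assumes "w \<in> crown"
  obtains g s where "g \<in> SL2" "\<i> * of_real s \<in> crown_strip" "w = coset_KC (crown_curve g (\<i> * of_real s))"
proof -
  obtain g X where g: "g \<in> SL2" and X: "X \<in> crown_Omega"
    and w: "w = coset_KC (complexify g ** exp_diag (map_matrix (\<lambda>x. \<i> * complex_of_real x) X))"
    using assms by (auto simp: crown_def)
  obtain s where s: "X = diag2 s (- s)" using X by (auto simp: crown_Omega_def lie_a_def)
  have "\<i> * of_real s \<in> crown_strip"
    using X by (simp add: crown_Omega_def root_alpha_def s crown_strip_def abs_mult)
  moreover have "w = coset_KC (crown_curve g (\<i> * of_real s))"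
    by (simp add: w s exp_diag_def crown_curve_def)
  ultimately show thesis using g that by blast
qed

section \<open>Holomorphy along the curves and analytic continuation\<close>

lemma bounded_linear_cmult_matrix:
  "bounded_linear (\<lambda>c. map_matrix (\<lambda>x. c * x) (M :: complex ^ 2 ^ 2))"
  unfolding linear_conv_bounded_linear [symmetric]
  by (rule linearI) (simp_all add: vec_eq_iff distrib_right)

text \<open>The derivative is put in the form of scaling a fixed matrix \<open>Z\<close> by
  \<open>c\<close>, which is the form on which complex linearity in
  \<open>complex_differentiable_at\<close> acts.\<close>

lemma crown_curve_has_derivative:
  obtains Z where "(crown_curve g has_derivative (\<lambda>c. map_matrix (\<lambda>x. c * x) Z)) (at z)"
proof -
  define M N where "M = complexify g ** diag2 1 0" and "N = complexify g ** diag2 0 1"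
  define Z where "Z = map_matrix (\<lambda>x. exp z * x) M - map_matrix (\<lambda>x. exp (- z) * x) N"
  have eq: "crown_curve g = (\<lambda>z. map_matrix (\<lambda>x. exp z * x) M + map_matrix (\<lambda>x. exp (- z) * x) N)"
    by (simp add: crown_curve_def M_def N_def fun_eq_iff vec_eq_iff forall_2 matrix_mult_2_nth mult.commute)
  have "(exp has_field_derivative exp z) (at z)"
    "((\<lambda>z. exp (- z)) has_field_derivative - exp (- z)) (at z)"
    by (auto intro!: derivative_eq_intros)
  from this [unfolded has_field_derivative_def, THEN bounded_linear.has_derivative [OF bounded_linear_cmult_matrix]]
  have "(crown_curve g has_derivative
     (\<lambda>c. map_matrix (\<lambda>x. exp z * c * x) M + map_matrix (\<lambda>x. - exp (- z) * c * x) N)) (at z)"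
    unfolding eq by (intro has_derivative_add)
  also have "(\<lambda>c. map_matrix (\<lambda>x. exp z * c * x) M + map_matrix (\<lambda>x. - exp (- z) * c * x) N)
      = (\<lambda>c. map_matrix (\<lambda>x. c * x) Z)"
    by (simp add: Z_def fun_eq_iff vec_eq_iff algebra_simps)
  finally show thesis by (rule that)
qed

text \<open>Near a point of the curve the pullback of \<open>F\<close> is the restriction of an
  ambient holomorphic \<open>h\<close>. The curve stays in the preimage of the crown, so the chain
  rule for \<open>h\<close> differentiates \<open>F\<close> along it.\<close>

lemma holomorphic_on_crown_curve:
  assumes F: "holomorphic_on_crown F" and g: "g \<in> SL2"
  shows "(\<lambda>z. F (coset_KC (crown_curve g z))) holomorphic_on crown_strip"
  unfolding holomorphic_on_open [OF crown_strip_open]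
proof
  fix z assume z: "z \<in> crown_strip"
  let ?U = "{w \<in> SL2. coset_KC w \<in> crown}"
  have U: "crown_curve g y \<in> ?U" if "y \<in> crown_strip" for y
    using coset_crown_curve_in_crown [OF g that] crown_curve_in_SL2 [OF g] by simp
  from F U [OF z] obtain W h where W: "open W" "crown_curve g z \<in> W"
    and diff: "\<And>w. w \<in> W \<Longrightarrow> complex_differentiable_at h w"
    and eq: "\<And>w. w \<in> W \<Longrightarrow> w \<in> ?U \<Longrightarrow> h w = F (coset_KC w)"
    unfolding holomorphic_on_crown_def holomorphic_on_SL2C_def by (metis (no_types, lifting) IntI)
  obtain D where D: "(h has_derivative D) (at (crown_curve g z))"
    and lin: "\<And>c X. D (map_matrix (\<lambda>x. c * x) X) = c * D X"
    using diff [OF W(2)] unfolding complex_differentiable_at_def by blast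
  obtain Z where Z: "(crown_curve g has_derivative (\<lambda>c. map_matrix (\<lambda>x. c * x) Z)) (at z)"
    by (rule crown_curve_has_derivative)
  have "((\<lambda>y. h (crown_curve g y)) has_derivative (\<lambda>c. D (map_matrix (\<lambda>x. c * x) Z))) (at z)"
    by (rule has_derivative_compose [OF Z D])
  then have der: "((\<lambda>y. h (crown_curve g y)) has_field_derivative D Z) (at z)"
    by (simp add: lin has_field_derivative_def mult.commute [of _ "D Z"])
  have "isCont (crown_curve g) y" for y
    by (rule crown_curve_has_derivative [of g y]) (rule has_derivative_continuous)
  then have "open (crown_curve g -` W)"
    by (intro continuous_open_vimage W) auto
  then have "open (crown_curve g -` W \<inter> crown_strip)"
    by (intro open_Int crown_strip_open)
  then have "((\<lambda>y. F (coset_KC (crown_curve g y))) has_field_derivative D Z) (at z)"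
    by (rule has_field_derivative_transform_within_open [OF der]) (use W(2) z eq U in auto)
  then show "\<exists>f'. ((\<lambda>z. F (coset_KC (crown_curve g z))) has_field_derivative f') (at z)" ..
qed

text \<open>Both sides are holomorphic on the connected strip and agree on the real axis, where the
  curve lies in the real group. The exponent enters only through the integral formula on that group,
  so either of the two symmetric exponents may be used.\<close>

lemma extension_eq_integral_cform:
  assumes F: "holomorphic_on_crown F" and g: "g \<in> SL2" and z: "z \<in> crown_strip"
    and eq: "\<And>g. g \<in> SL2 \<Longrightarrow> F (coset_KC (complexify g))
      = integral {0..2 * pi} (\<lambda>t. of_real (qform g t) powr \<nu>) / of_real (2 * pi)"
  shows "F (coset_KC (crown_curve g z)) = integral {0..2 * pi} (\<lambda>t. cform g z t powr \<nu>) / of_real (2 * pi)"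
proof -
  let ?f = "\<lambda>z. F (coset_KC (crown_curve g z)) - integral {0..2 * pi} (\<lambda>t. cform g z t powr \<nu>) / of_real (2 * pi)"
  have "?f z = 0"
  proof (rule analytic_continuation [of ?f crown_strip \<real> 0])
    show "?f holomorphic_on crown_strip"
      by (intro holomorphic_intros holomorphic_on_crown_curve holomorphic_integral_cform F g) simp
    show "connected crown_strip" by (rule convex_connected [OF crown_strip_convex])
    show "\<real> \<subseteq> crown_strip" by (auto simp: crown_strip_def Reals_def)
    show "(0::complex) islimpt \<real>"
    proof (rule islimptI)
      fix T :: "complex set" assume "0 \<in> T" "open T"
      then obtain e where e: "e > 0" "ball 0 e \<subseteq> T" by (meson openE)
      then have "of_real (e / 2) \<in> T" by (intro subsetD [OF e(2)]) simp
      then show "\<exists>y\<in>\<real>. y \<in> T \<and> y \<noteq> 0"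
        using e(1) by (intro bexI [of _ "of_real (e / 2)"]) auto
    qed
    fix x :: complex assume "x \<in> \<real>"
    then obtain s where s: "x = of_real s" by (auto simp: Reals_def)
    have "g ** diag2 (exp s) (exp (- s)) \<in> SL2" by (intro SL2_mult g diag2_exp_in_SL2)
    then show "?f x = 0"
      by (simp add: s crown_curve_of_real cform_of_real eq)
  qed (use z crown_strip_open in \<open>auto simp: crown_strip_def\<close>)
  then show ?thesis by simp
qed

theorem theorem5p2:
  fixes l :: "real ^ 2 ^ 2 \<Rightarrow> complex"
    and F :: "(complex ^ 2 ^ 2) set \<Rightarrow> complex"
  assumes "l \<in> pos_def_params"
    and "holomorphic_extension_to_crown (spherical l) F"
  shows "bounded (F ` crown)"
proof -
  define \<nu> where "\<nu> = spherical_exponent l"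
  have l: "l \<in> a_dual_C" using assms(1) by (simp add: pos_def_params_def)
  have \<nu>: "- 1 \<le> Re \<nu>" "Re \<nu> \<le> 0"
    using pos_def_params_exponent [OF assms(1)] by (simp_all add: \<nu>_def)
  have F: "holomorphic_on_crown F"
    and ext: "\<And>g. g \<in> SL2 \<Longrightarrow> F (coset_KC (complexify g)) = legendre \<nu> (cosh_dist g)"
    using assms(2) by (auto simp: holomorphic_extension_to_crown_def spherical_eq_legendre l \<nu>_def)
  define \<mu> where "\<mu> = (if - 1/2 \<le> Re \<nu> then \<nu> else - 1 - \<nu>)"
  have \<mu>: "- 1/2 \<le> Re \<mu>" "Re \<mu> \<le> 0" using \<nu> by (auto simp: \<mu>_def)
  \<comment> \<open>The symmetry of the Legendre function allows the more favorable exponent \<mu>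
    on the real group, before any continuation.\<close>
  have eq: "F (coset_KC (complexify g))
      = integral {0..2 * pi} (\<lambda>t. of_real (qform g t) powr \<mu>) / of_real (2 * pi)" if g: "g \<in> SL2" for g
    unfolding integral_qform_eq_legendre [OF g] ext [OF g] \<mu>_def
    by (simp add: legendre_symmetric cosh_dist_ge_1 g)
  define B where "B = exp (pi * \<bar>Im \<mu>\<bar>) * (2 * pi + 2 * integral {0..2 * pi} (\<lambda>t. 1 / sqrt \<bar>sin t\<bar>))"
  show ?thesis
  proof (rule boundedI)
    fix y assume "y \<in> F ` crown"
    then obtain w where w: "w \<in> crown" "y = F w" by blast
    obtain g s where g: "g \<in> SL2" and s: "\<i> * of_real s \<in> crown_strip"
      and ws: "w = coset_KC (crown_curve g (\<i> * of_real s))"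
      using crown_imp_crown_curve [OF w(1)] by metis
    have "y = integral {0..2 * pi} (\<lambda>t. cform g (\<i> * of_real s) t powr \<mu>) / of_real (2 * pi)"
      unfolding w(2) ws by (rule extension_eq_integral_cform [OF F g s eq])
    then have "norm y = cmod (integral {0..2 * pi} (\<lambda>t. cform g (\<i> * of_real s) t powr \<mu>)) / (2 * pi)"
      by (simp add: norm_divide norm_mult)
    also have "\<dots> \<le> B / (2 * pi)"
      unfolding B_def using integral_cform_powr_le [OF g s \<mu>] by (intro divide_right_mono) auto
    finally show "norm y \<le> B / (2 * pi)" .
  qed
qed

end
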